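(* Let $\alpha\in(0,\infty)\setminus\{1\}$ and $p>0$. (1) Let $0<\alpha<1$. If $\mathrm{Tr}\,SG_{\alpha,p}$ is jointly concave, then $p\le\min\bigl\{\frac{1-\alpha}{\alpha},\frac{\alpha}{1-\alpha}\bigr\}$. If $\mathrm{Tr}\,\widetilde{SG}_{\alpha,p}$ is jointly concave, then $p\le1$. (2) For any $\alpha>1$ and any $p>0$, neither $\mathrm{Tr}\,SG_{\alpha,p}$ nor $\mathrm{Tr}\,\widetilde{SG}_{\alpha,p}$ is jointly convex.
   Context: Notation: $\mathbb{M}_n^+$ (resp. $\mathbb{M}_n^{++}$) is the set of $n\times n$ complex positive semidefinite (resp. positive definite) matrices; $s(A)$ is the support projection of $A\ge0$. $A^{-1}$ denotes the generalized inverse (inverse on the support of $A$, zero on the kernel), and $A^r:=(A^{-1})^{-r}$ for $r<0$. For $\alpha>0$ and $A,B\ge0$ with $s(A)\ge s(B)$, $A\#_\alpha B:=A^{1/2}(A^{-1/2}BA^{-1/2})^{\alpha}A^{1/2}$, $\#:=\#_{1/2}$, and - $SG_{\alpha,p}(A,B):=\bigl((A^{-p}\#B^p)^{\alpha}A^p(A^{-p}\#B^p)^{\alpha}\bigr)^{1/p}$; - $\widetilde{SG}_{\alpha,p}(A,B):=\bigl((A^{-p}\#_\alpha B^p)^{1/2}A^{2(1-\alpha)p}(A^{-p}\#_\alpha B^p)^{1/2}\bigr)^{1/p}$. For either of these means $\mathcal{M}$, "$\mathrm{Tr}\,\mathcal{M}$ is jointly concave (convex)" means that $(A,B)\mapsto\mathrm{Tr}\,\mathcal{M}(A,B)$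 is jointly concave (convex) on $\{(A,B)\in\mathbb{M}_n^+\times\mathbb{M}_n^+:s(A)\ge s(B)\}$ for every $n\in\mathbb{N}$; equivalently, on $\mathbb{M}_n^{++}\times\mathbb{M}_n^{++}$ for every $n\in\mathbb{N}$. *)

theory Defs
  imports Complex_Main "Jordan_Normal_Form.Schur_Decomposition"
begin

section \<open>Positive semidefinite matrices and functional calculus\<close>

text \<open>The order on \<^typ>\<open>complex\<close> is the one in which \<open>0 \<le> z\<close> means that \<open>z\<close> is real and
  nonnegative. Hence \<open>psd\<close> implies Hermitian symmetry.\<close>

definition psd :: "nat \<Rightarrow> complex mat \<Rightarrow> bool" where
  "psd n A \<longleftrightarrow> A \<in> carrier_mat n n \<and> (\<forall>v\<in>carrier_vec n. 0 \<le> (A *\<^sub>v v) \<bullet>c v)"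

definition loewner_le :: "nat \<Rightarrow> complex mat \<Rightarrow> complex mat \<Rightarrow> bool" where
  "loewner_le n A B \<longleftrightarrow> A \<in> carrier_mat n n \<and> B \<in> carrier_mat n n \<and> psd n (B - A)"

definition unitary_mat :: "nat \<Rightarrow> complex mat \<Rightarrow> bool" where
  "unitary_mat n U \<longleftrightarrow> U \<in> carrier_mat n n \<and> mat_adjoint U * U = 1\<^sub>m n \<and> U * mat_adjoint U = 1\<^sub>m n"

definition real_diag :: "nat \<Rightarrow> (nat \<Rightarrow> real) \<Rightarrow> complex mat" where
  "real_diag n d = mat_diag n (\<lambda>i. complex_of_real (d i))"

text \<open>\<open>mat_fun f A\<close> is \<open>f(A)\<close> for a Hermitian matrix \<open>A\<close>; it does not depend on the spectral
  decomposition chosen, see \<open>mat_fun_eq\<close> below. For other matrices it is unspecified.\<close>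

definition mat_fun :: "(real \<Rightarrow> real) \<Rightarrow> complex mat \<Rightarrow> complex mat" where
  "mat_fun f A = (THE X. \<exists>U d. unitary_mat (dim_row A) U
      \<and> A = U * real_diag (dim_row A) d * mat_adjoint U
      \<and> X = U * real_diag (dim_row A) (\<lambda>i. f (d i)) * mat_adjoint U)"

lemma adjoint_carrier [simp]:
  "A \<in> carrier_mat n m \<Longrightarrow> mat_adjoint A \<in> carrier_mat m n"
  unfolding mat_adjoint_def by auto

lemma real_diag_carrier [simp]: "real_diag n d \<in> carrier_mat n n"
  by (simp add: real_diag_def)

lemma mat_fun_eq:
  assumes U: "unitary_mat n U"
  shows "mat_fun f (U * real_diag n d * mat_adjoint U)
       = U * real_diag n (\<lambda>i. f (d i)) * mat_adjoint U"
proof -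
  let ?a = mat_adjoint
  let ?A = "U * real_diag n d * ?a U"
  have Uc: "U \<in> carrier_mat n n" and UU: "?a U * U = 1\<^sub>m n" "U * ?a U = 1\<^sub>m n"
    using U by (auto simp: unitary_mat_def)
  have dr: "dim_row ?A = n" using Uc by auto
  have uniq: "V * real_diag n (\<lambda>i. f (e i)) * ?a V = U * real_diag n (\<lambda>i. f (d i)) * ?a U"
    if V: "unitary_mat n V" and AV: "?A = V * real_diag n e * ?a V" for V e
  proof -
    have Vc: "V \<in> carrier_mat n n" and VV: "?a V * V = 1\<^sub>m n" "V * ?a V = 1\<^sub>m n"
      using V by (auto simp: unitary_mat_def)
    define W where "W = ?a V * U"
    have Wc: "W \<in> carrier_mat n n"
      using mult_carrier_mat[OF adjoint_carrier[OF Vc] Uc] unfolding W_def .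
    note aU = adjoint_carrier[OF Uc] and aV = adjoint_carrier[OF Vc]
    note ac = assoc_mult_mat[of _ n n _ n _ n] and cl = mult_carrier_mat[of _ n n _ n]
    have conj: "?a V * (Y * D * ?a Y) * U = (?a V * Y) * D * (?a Y * U)"
      if "Y \<in> carrier_mat n n" "D \<in> carrier_mat n n" for Y D
      using that Uc aV adjoint_carrier[OF that(1)] by (simp add: ac cl)
    have U1: "?a V * (U * D * ?a U) * U = W * D" if "D \<in> carrier_mat n n" for D
      using conj[OF Uc that] right_mult_one_mat[OF cl[OF Wc that]] UU by (simp add: W_def)
    have V1: "?a V * (V * D * ?a V) * U = D * W" if "D \<in> carrier_mat n n" for D
      using conj[OF Vc that] left_mult_one_mat[OF that] VV by (simp add: W_def)
    have WD: "W * real_diag n d = real_diag n e * W"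
      using U1[OF real_diag_carrier, of d] V1[OF real_diag_carrier, of e] unfolding AV by simp
    have ent: "W $$ (i,j) * of_real (d j) = of_real (e i) * W $$ (i,j)" if "i < n" "j < n" for i j
      using arg_cong[OF WD, of "\<lambda>M. M $$ (i,j)"] that Wc
      by (simp add: real_diag_def mat_diag_mult_left[OF Wc] mat_diag_mult_right[OF Wc])
    have WF: "W * real_diag n (\<lambda>i. f (d i)) = real_diag n (\<lambda>i. f (e i)) * W"
    proof (rule eq_matI)
      fix i j assume "i < dim_row (real_diag n (\<lambda>i. f (e i)) * W)"
        and "j < dim_col (real_diag n (\<lambda>i. f (e i)) * W)"
      then have ij: "i < n" "j < n" using Wc by (auto simp: real_diag_def mat_diag_def)
      have "W $$ (i,j) = 0 \<or> d j = e i"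
        using ent[OF ij] by (simp add: mult.commute[of "W $$ (i,j)"])
      then show "(W * real_diag n (\<lambda>i. f (d i))) $$ (i,j) = (real_diag n (\<lambda>i. f (e i)) * W) $$ (i,j)"
        using ij Wc by (auto simp: real_diag_def mat_diag_mult_left[OF Wc] mat_diag_mult_right[OF Wc])
    qed (use Wc in \<open>auto simp: real_diag_def mat_diag_def\<close>)
    have VW: "V * W = U"
      using ac[OF Vc aV Uc] VV left_mult_one_mat[OF Uc] by (simp add: W_def)
    have WU: "W * ?a U = ?a V"
      using ac[OF aV Uc aU] UU right_mult_one_mat[OF aV] by (simp add: W_def)
    let ?D = "real_diag n (\<lambda>i. f (d i))" and ?E = "real_diag n (\<lambda>i. f (e i))"
    have "U * ?D * ?a U = V * (W * ?D) * ?a U"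
      using ac[OF Vc Wc real_diag_carrier] VW by simp
    also have "\<dots> = V * ?E * (W * ?a U)"
      using Vc Wc aU by (simp add: WF ac cl)
    finally show ?thesis by (simp add: WU)
  qed
  show ?thesis unfolding mat_fun_def dr
  proof (rule the_equality, goal_cases)
    case 1
    show ?case using U by blast
  next
    case (2 X)
    then obtain V e where V: "unitary_mat n V" "?A = V * real_diag n e * ?a V"
      and X: "X = V * real_diag n (\<lambda>i. f (e i)) * ?a V" by blast
    show ?case unfolding X by (rule uniq[OF V])
  qed
qed

definition support_proj :: "complex mat \<Rightarrow> complex mat" where
  "support_proj A = mat_fun (\<lambda>x. if x = 0 then 0 else 1) A"

text \<open>Generalized inverse: \<^prop>\<open>inverse 0 = (0::real)\<close>.\<close>

definition gen_inv :: "complex mat \<Rightarrow> complex mat" where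
  "gen_inv A = mat_fun inverse A"

text \<open>Since \<^prop>\<open>0 powr 0 = (0::real)\<close>, the exponent \<open>0\<close> yields the support projection.\<close>

definition mat_powr :: "complex mat \<Rightarrow> real \<Rightarrow> complex mat" where
  "mat_powr A r = (if r < 0 then mat_fun (\<lambda>x. x powr (- r)) (gen_inv A)
                   else mat_fun (\<lambda>x. x powr r) A)"

definition mat_trace :: "complex mat \<Rightarrow> complex" where
  "mat_trace A = (\<Sum>i<dim_row A. A $$ (i,i))"

section \<open>The two means\<close>

definition wgeo_mean :: "real \<Rightarrow> complex mat \<Rightarrow> complex mat \<Rightarrow> complex mat" where
  "wgeo_mean \<alpha> A B =
     mat_powr A (1/2) * mat_powr (mat_powr A (-1/2) * B * mat_powr A (-1/2)) \<alpha> * mat_powr A (1/2)"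

definition SG :: "real \<Rightarrow> real \<Rightarrow> complex mat \<Rightarrow> complex mat \<Rightarrow> complex mat" where
  "SG \<alpha> p A B =
     (let G = wgeo_mean (1/2) (mat_powr A (-p)) (mat_powr B p)
      in mat_powr (mat_powr G \<alpha> * mat_powr A p * mat_powr G \<alpha>) (1/p))"

definition SG_tilde :: "real \<Rightarrow> real \<Rightarrow> complex mat \<Rightarrow> complex mat \<Rightarrow> complex mat" where
  "SG_tilde \<alpha> p A B =
     (let G = wgeo_mean \<alpha> (mat_powr A (-p)) (mat_powr B p)
      in mat_powr (mat_powr G (1/2) * mat_powr A (2 * (1 - \<alpha>) * p) * mat_powr G (1/2)) (1/p))"

section \<open>Joint concavity and convexity of the trace\<close>

definition mean_domain :: "nat \<Rightarrow> (complex mat \<times> complex mat) set" where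
  "mean_domain n = {(A, B). psd n A \<and> psd n B \<and> loewner_le n (support_proj B) (support_proj A)}"

definition mat_convex_comb :: "real \<Rightarrow> complex mat \<Rightarrow> complex mat \<Rightarrow> complex mat" where
  "mat_convex_comb t A B = complex_of_real (1 - t) \<cdot>\<^sub>m A + complex_of_real t \<cdot>\<^sub>m B"

text \<open>The library's \<open>concave_on\<close> and \<open>convex_on\<close> need a vector space type, which \<^typ>\<open>complex mat\<close>
  (matrices of all sizes) is not. On \<open>mean_domain n\<close> both means are positive semidefinite, so
  taking the real part of their trace loses nothing.\<close>

definition trace_jointly_concave :: "(complex mat \<Rightarrow> complex mat \<Rightarrow> complex mat) \<Rightarrow> bool" where
  "trace_jointly_concave M \<longleftrightarrow>
     (\<forall>n\<ge>1. \<forall>(A, B) \<in> mean_domain n. \<forall>(A', B') \<in> mean_domain n. \<forall>t\<in>{0..1}.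
        (1 - t) * Re (mat_trace (M A B)) + t * Re (mat_trace (M A' B'))
          \<le> Re (mat_trace (M (mat_convex_comb t A A') (mat_convex_comb t B B'))))"

definition trace_jointly_convex :: "(complex mat \<Rightarrow> complex mat \<Rightarrow> complex mat) \<Rightarrow> bool" where
  "trace_jointly_convex M \<longleftrightarrow>
     (\<forall>n\<ge>1. \<forall>(A, B) \<in> mean_domain n. \<forall>(A', B') \<in> mean_domain n. \<forall>t\<in>{0..1}.
        Re (mat_trace (M (mat_convex_comb t A A') (mat_convex_comb t B B')))
          \<le> (1 - t) * Re (mat_trace (M A B)) + t * Re (mat_trace (M A' B')))"

end

theory Submission
  imports Defs
begin

text \<open>All counterexamples are real matrices of size 2. If \<open>B = b u u\<^sup>T\<close> with a unit vector \<open>u\<close>, then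
  \<open>Tr SG(A,B)\<close> is \<open>b\<^sup>\<alpha>\<close> times the power \<open>(1 - \<alpha>)/p\<close> of \<open>\<langle>u, A\<^sup>p u\<rangle>\<close>, which for diagonal \<open>A\<close> and \<open>p > 1\<close> has the wrong curvature; the analogous formula for the second mean excludes
  concavity for every \<open>\<alpha> \<noteq> 1/2\<close> and convexity for every \<open>\<alpha> > 1\<close>, because a nonnegative jointly
  concave trace is monotone in both arguments and a jointly convex homogeneous one is decreasing
  in \<open>A\<close>. For \<open>SG\<close> with \<open>p \<le> 1\<close>, write \<open>B\<^sup>p = G A\<^sup>p G\<close>, so that
  \<open>SG(A,B)\<^sup>p = G\<^sup>\<alpha> A\<^sup>p G\<^sup>\<alpha>\<close>, and let the eigenvalues of \<open>G\<close> be \<open>1\<close> and a small \<open>g\<close>. Then adding the small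
  spectral part of \<open>B\<close> to its large rank one part changes the trace by a negative (\<open>\<alpha> < 1\<close>) or
  positive (\<open>\<alpha> > 1\<close>) amount of order \<open>g\<close>, which contradicts monotonicity for \<open>1/2 < \<alpha> < 1\<close> and
  convexity for \<open>\<alpha> > 1\<close>; the symmetry exchanging \<open>(A, \<alpha>)\<close> and \<open>(B, 1 - \<alpha>)\<close> gives \<open>\<alpha> < 1/2\<close>. So the
  trace of \<open>SG\<close> can be jointly concave only for \<open>\<alpha> = 1/2\<close> and \<open>p \<le> 1\<close>.\<close>

section \<open>Real matrices of size 2\<close>

definition rmat :: "real \<Rightarrow> real \<Rightarrow> real \<Rightarrow> real \<Rightarrow> complex mat" where
  "rmat a b c d = mat 2 2 (\<lambda>(i,j). complex_of_real
     (if i = 0 then (if j = 0 then a else b) else (if j = 0 then c else d)))"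

text \<open>The matrix with eigenvalues \<open>l\<close>, \<open>k\<close> and eigenvectors \<open>(x, y)\<close>, \<open>(-y, x)\<close>; meaningful
  only for \<open>x\<^sup>2 + y\<^sup>2 = 1\<close>.\<close>

definition rot_diag :: "real \<Rightarrow> real \<Rightarrow> real \<Rightarrow> real \<Rightarrow> complex mat" where
  "rot_diag x y l k = rmat (l * x\<^sup>2 + k * y\<^sup>2) ((l - k) * x * y) ((l - k) * x * y) (l * y\<^sup>2 + k * x\<^sup>2)"

lemma rmat_carrier [simp]: "rmat a b c d \<in> carrier_mat 2 2"
  by (simp add: rmat_def)

lemma rmat_dim [simp]: "dim_row (rmat a b c d) = 2" "dim_col (rmat a b c d) = 2"
  by (simp_all add: rmat_def)

lemma rmat_eq_iff: "rmat a b c d = rmat a' b' c' d' \<longleftrightarrow> a = a' \<and> b = b' \<and> c = c' \<and> d = d'"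
proof
  assume eq: "rmat a b c d = rmat a' b' c' d'"
  have "rmat a b c d $$ (i,j) = rmat a' b' c' d' $$ (i,j)" for i j
    by (simp add: eq)
  from this[of 0 0] this[of 0 1] this[of 1 0] this[of 1 1]
  show "a = a' \<and> b = b' \<and> c = c' \<and> d = d'" by (simp add: rmat_def)
qed simp

lemma less_2_nat: "(i::nat) < 2 \<longleftrightarrow> i = 0 \<or> i = 1"
  by auto

lemma rmat_mult:
  "rmat a b c d * rmat a' b' c' d' =
   rmat (a * a' + b * c') (a * b' + b * d') (c * a' + d * c') (c * b' + d * d')"
  by (rule eq_matI) (auto simp: rmat_def less_2_nat scalar_prod_def numeral_2_eq_2)

lemma rmat_add: "rmat a b c d + rmat a' b' c' d' = rmat (a + a') (b + b') (c + c') (d + d')"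
  by (rule eq_matI) (auto simp: rmat_def)

lemma rmat_minus: "rmat a b c d - rmat a' b' c' d' = rmat (a - a') (b - b') (c - c') (d - d')"
  by (rule eq_matI) (auto simp: rmat_def)

lemma rmat_smult: "complex_of_real t \<cdot>\<^sub>m rmat a b c d = rmat (t * a) (t * b) (t * c) (t * d)"
  by (rule eq_matI) (auto simp: rmat_def)

lemma rmat_adjoint: "mat_adjoint (rmat a b c d) = rmat a c b d"
  by (rule eq_matI) (auto simp: rmat_def mat_adjoint_def mat_of_rows_def less_2_nat)

lemma rmat_one: "1\<^sub>m 2 = rmat 1 0 0 1"
  by (rule eq_matI) (auto simp: rmat_def)

lemma real_diag_2: "real_diag 2 d = rmat (d 0) 0 0 (d 1)"
  by (rule eq_matI) (auto simp: rmat_def real_diag_def mat_diag_def less_2_nat)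

lemma mat_trace_rmat: "Re (mat_trace (rmat a b c d)) = a + d"
  by (simp add: mat_trace_def rmat_def numeral_2_eq_2)

lemma mat_trace_rot_diag:
  assumes "x\<^sup>2 + y\<^sup>2 = 1"
  shows "Re (mat_trace (rot_diag x y l k)) = l + k"
proof -
  have "Re (mat_trace (rot_diag x y l k)) = (l + k) * (x\<^sup>2 + y\<^sup>2)"
    by (simp add: rot_diag_def mat_trace_rmat algebra_simps)
  then show ?thesis by (simp add: assms)
qed

text \<open>The rotation with columns \<open>(x, y)\<close> and \<open>(-y, x)\<close> diagonalizes
  the matrix, so \<open>mat_fun_eq\<close> applies.\<close>

lemma mat_fun_rot_diag:
  assumes "x\<^sup>2 + y\<^sup>2 = 1"
  shows "mat_fun f (rot_diag x y l k) = rot_diag x y (f l) (f k)"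
proof -
  let ?U = "rmat x (- y) y x"
  have U: "unitary_mat 2 ?U"
    using assms by (simp add: unitary_mat_def rmat_adjoint rmat_mult rmat_one rmat_eq_iff power2_eq_square algebra_simps)
  have D: "rot_diag x y l k = ?U * real_diag 2 (\<lambda>i. if i = 0 then l else k) * mat_adjoint ?U" for l k
    by (simp add: rot_diag_def rmat_adjoint rmat_mult real_diag_2 rmat_eq_iff power2_eq_square algebra_simps)
  show ?thesis
    unfolding D mat_fun_eq[OF U] by (simp add: if_distrib cong: if_cong)
qed

text \<open>Since \<open>0 powr r = 0\<close> for every \<open>r\<close>, the detour through
  \<open>gen_inv\<close> for negative exponents yields the same formula on the kernel.\<close>

lemma mat_powr_rot_diag:
  assumes xy: "x\<^sup>2 + y\<^sup>2 = 1" and "0 \<le> l" "0 \<le> k"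
  shows "mat_powr (rot_diag x y l k) r = rot_diag x y (l powr r) (k powr r)"
  using assms(2,3)
  by (auto simp: mat_powr_def gen_inv_def mat_fun_rot_diag[OF xy] powr_minus
      inverse_powr)

lemma rot_diag_mult:
  assumes "x\<^sup>2 + y\<^sup>2 = 1"
  shows "rot_diag x y l k * rot_diag x y l' k' = rot_diag x y (l * l') (k * k')"
proof -
  have X: "x * x = 1 - y * y" using assms by (simp add: power2_eq_square)
  have X2: "x * (x * z) = (1 - y * y) * z" for z by (simp add: X flip: mult.assoc)
  show ?thesis
    unfolding rot_diag_def rmat_mult rmat_eq_iff
    by (simp add: power2_eq_square X X2 algebra_simps)
qed

lemma rot_diag_const:
  assumes "x\<^sup>2 + y\<^sup>2 = 1"
  shows "rot_diag x y l l = rmat l 0 0 l"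
  using assms by (simp add: rot_diag_def rmat_eq_iff flip: distrib_left)

section \<open>Positive semidefinite matrices, their diagonalization and powers\<close>

text \<open>The test by principal minors, which turns positivity into polynomial inequalities in the
  entries.\<close>

definition rpsd :: "complex mat \<Rightarrow> bool" where
  "rpsd M \<longleftrightarrow> (\<exists>a b c. M = rmat a b b c \<and> 0 \<le> a \<and> 0 \<le> c \<and> b\<^sup>2 \<le> a * c)"

lemma rpsd_rmat: "rpsd (rmat a b b c) \<longleftrightarrow> 0 \<le> a \<and> 0 \<le> c \<and> b\<^sup>2 \<le> a * c"
  by (auto simp: rpsd_def rmat_eq_iff)

lemma rpsd_rot_diag:
  assumes "0 \<le> l" "0 \<le> k"
  shows "rpsd (rot_diag x y l k)"
proof -
  have "(l * x\<^sup>2 + k * y\<^sup>2) * (l * y\<^sup>2 + k * x\<^sup>2) - ((l - k) * x * y)\<^sup>2 = l * k * (x\<^sup>2 + y\<^sup>2)\<^sup>2"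
    by (simp add: power2_eq_square algebra_simps)
  moreover have "0 \<le> l * k * (x\<^sup>2 + y\<^sup>2)\<^sup>2" using assms by simp
  ultimately have "((l - k) * x * y)\<^sup>2 \<le> (l * x\<^sup>2 + k * y\<^sup>2) * (l * y\<^sup>2 + k * x\<^sup>2)" by linarith
  then show ?thesis
    unfolding rot_diag_def rpsd_rmat using assms by simp
qed

text \<open>Half the diagonal difference and the off-diagonal entry have polar coordinates
  \<open>s\<close>, \<open>\<theta>\<close>. Rotation by \<open>\<theta> / 2\<close> then
  diagonalizes, with eigenvalues \<open>(a + c) / 2\<close> plus or minus \<open>s\<close>.\<close>

lemma rpsd_diagonalize:
  assumes "rpsd M"
  obtains x y l k where "x\<^sup>2 + y\<^sup>2 = 1" "0 \<le> l" "0 \<le> k" "M = rot_diag x y l k"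
proof -
  obtain a b c where M: "M = rmat a b b c" and nn: "0 \<le> a" "0 \<le> c" "b\<^sup>2 \<le> a * c"
    using assms by (auto simp: rpsd_def)
  define e where "e = (a - c) / 2"
  define s where "s = sqrt (e\<^sup>2 + b\<^sup>2)"
  define l where "l = (a + c) / 2 + s"
  define k where "k = (a + c) / 2 - s"
  obtain \<theta> where th: "e = s * cos \<theta>" "b = s * sin \<theta>"
  proof (cases "s = 0")
    case True
    then have "e\<^sup>2 + b\<^sup>2 = 0" by (simp add: s_def)
    then show thesis using that[of 0] True by (simp add: sum_power2_eq_zero_iff)
  next
    case False
    then have s: "s > 0" "s\<^sup>2 = e\<^sup>2 + b\<^sup>2"
      by (auto simp: s_def less_le sum_power2_eq_zero_iff)
    then have "(e / s)\<^sup>2 + (b / s)\<^sup>2 = 1"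
      by (simp add: power_divide flip: add_divide_distrib s(2))
    then obtain t where "e / s = cos t" "b / s = sin t"
      using sincos_total_2pi by blast
    then show thesis using that[of t] s by (simp add: field_simps)
  qed
  let ?x = "cos (\<theta> / 2)" and ?y = "sin (\<theta> / 2)"
  have c2: "cos \<theta> = ?x\<^sup>2 - ?y\<^sup>2" "sin \<theta> = 2 * ?y * ?x"
    using cos_double[of "\<theta> / 2"] sin_double[of "\<theta> / 2"] by simp_all
  have xy: "?x\<^sup>2 + ?y\<^sup>2 = 1" by simp
  then have y2: "?y\<^sup>2 = 1 - ?x\<^sup>2" by linarith
  have e2: "e = s * (2 * ?x\<^sup>2 - 1)" using th c2 y2 by simp
  have "l * ?x\<^sup>2 + k * ?y\<^sup>2 = (a + c) / 2 + e"
    unfolding y2 l_def k_def e2 by (simp add: algebra_simps)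
  moreover have "l * ?y\<^sup>2 + k * ?x\<^sup>2 = (a + c) / 2 - e"
    unfolding y2 l_def k_def e2 by (simp add: algebra_simps)
  moreover have "(l - k) * ?x * ?y = b"
    using th c2 by (simp add: l_def k_def)
  ultimately have "M = rot_diag ?x ?y l k"
    by (simp add: M rot_diag_def rmat_eq_iff e_def field_simps)
  \<comment> \<open>The determinant condition \<open>b\<^sup>2 \<le> a * c\<close> in another form;
    it makes \<open>k\<close> nonnegative.\<close>
  moreover have "s \<le> (a + c) / 2"
    unfolding s_def e_def using nn by (intro real_le_lsqrt) (auto simp: power2_eq_square field_simps)
  moreover have "0 \<le> s" by (simp add: s_def)
  ultimately show thesis using that[of ?x ?y l k] xy nn unfolding l_def k_def by auto
qed

lemma rpsd_mat_powr:
  assumes "rpsd M" shows "rpsd (mat_powr M r)"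
  using assms by (elim rpsd_diagonalize) (simp add: mat_powr_rot_diag rpsd_rot_diag)

lemma mat_powr_mat_powr:
  assumes "rpsd M" shows "mat_powr (mat_powr M r) s = mat_powr M (r * s)"
  using assms by (elim rpsd_diagonalize) (simp add: mat_powr_rot_diag powr_powr)

lemma mat_powr_one:
  assumes "rpsd M" shows "mat_powr M 1 = M"
  using assms by (elim rpsd_diagonalize) (simp add: mat_powr_rot_diag)

lemma mat_powr_square_half:
  assumes "rpsd M" shows "mat_powr (M * M) (1/2) = M"
  using assms by (elim rpsd_diagonalize) (simp add: mat_powr_rot_diag rot_diag_mult powr_half_sqrt)

definition qform :: "real \<Rightarrow> real \<Rightarrow> complex mat \<Rightarrow> real" where
  "qform x y M = Re (M $$ (0,0)) * x\<^sup>2 + (Re (M $$ (0,1)) + Re (M $$ (1,0))) * x * y + Re (M $$ (1,1)) * y\<^sup>2"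

lemma qform_rmat: "qform x y (rmat a b c d) = a * x\<^sup>2 + (b + c) * x * y + d * y\<^sup>2"
  by (simp add: qform_def rmat_def)

text \<open>The diagonal entries of \<open>K * M * K\<close> are values of the form of
  \<open>M\<close> at the rows of \<open>K\<close>, and its determinant is
  \<open>det(K)^2 det(M)\<close>.\<close>

lemma rpsd_conj:
  assumes "rpsd K" "rpsd M" shows "rpsd (K * M * K)"
proof -
  obtain a b c where K: "K = rmat a b b c" using assms by (auto simp: rpsd_def)
  obtain p q r where M: "M = rmat p q q r" and nn: "0 \<le> p" "0 \<le> r" "q\<^sup>2 \<le> p * r"
    using assms by (auto simp: rpsd_def)
  have nonneg: "0 \<le> p * s\<^sup>2 + 2 * q * s * t + r * t\<^sup>2" for s t :: real
  proof (cases "p = 0")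
    case True
    then show ?thesis using nn by simp
  next
    case False
    have "p * (p * s\<^sup>2 + 2 * q * s * t + r * t\<^sup>2) = (p * s + q * t)\<^sup>2 + (p * r - q\<^sup>2) * t\<^sup>2"
      by (simp add: power2_eq_square algebra_simps)
    also have "\<dots> \<ge> 0" using nn by simp
    finally show ?thesis using False nn by (simp add: zero_le_mult_iff)
  qed
  have "K * M * K = rmat (p * a\<^sup>2 + 2 * q * a * b + r * b\<^sup>2) (a * b * p + (a * c + b\<^sup>2) * q + b * c * r)
      (a * b * p + (a * c + b\<^sup>2) * q + b * c * r) (p * b\<^sup>2 + 2 * q * b * c + r * c\<^sup>2)"
    by (simp add: K M rmat_mult rmat_eq_iff power2_eq_square algebra_simps)
  moreover have "(p * a\<^sup>2 + 2 * q * a * b + r * b\<^sup>2) * (p * b\<^sup>2 + 2 * q * b * c + r * c\<^sup>2)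
      - (a * b * p + (a * c + b\<^sup>2) * q + b * c * r)\<^sup>2 = (a * c - b\<^sup>2)\<^sup>2 * (p * r - q\<^sup>2)"
    by (simp add: power2_eq_square algebra_simps)
  moreover have "0 \<le> (a * c - b\<^sup>2)\<^sup>2 * (p * r - q\<^sup>2)" using nn by simp
  ultimately show ?thesis unfolding rpsd_def using nonneg by (metis diff_ge_0_iff_ge)
qed

lemma rpsd_trace_nonneg:
  assumes "rpsd M" shows "0 \<le> Re (mat_trace M)"
  using assms by (auto simp: rpsd_def mat_trace_rmat)

text \<open>Passage to complex vectors: in the eigenbasis the form is a sum of squared moduli of
  coordinates weighted by \<open>l\<close> and \<open>k\<close>.\<close>

lemma psd_rpsd:
  assumes "rpsd M" shows "psd 2 M"
proof -
  obtain x y l k where xy: "x\<^sup>2 + y\<^sup>2 = 1" "0 \<le> l" "0 \<le> k" and M: "M = rot_diag x y l k"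
    using assms by (rule rpsd_diagonalize)
  have "0 \<le> (M *\<^sub>v v) \<bullet>c v" if v: "v \<in> carrier_vec 2" for v
  proof -
    define s where "s = v $ 0"
    define t where "t = v $ 1"
    have "(M *\<^sub>v v) \<bullet>c v = (of_real l * ((of_real x * s + of_real y * t) * cnj (of_real x * s + of_real y * t)))
       + of_real k * ((of_real x * t - of_real y * s) * cnj (of_real x * t - of_real y * s))"
      using v by (simp add: M rot_diag_def rmat_def scalar_prod_def numeral_2_eq_2 s_def t_def power2_eq_square algebra_simps)
    also have "\<dots> = of_real (l * (cmod (of_real x * s + of_real y * t))\<^sup>2 + k * (cmod (of_real x * t - of_real y * s))\<^sup>2)"
      by (simp only: of_real_add of_real_mult complex_norm_square[symmetric] of_real_power)
    finally show ?thesis using xy by (simp add: less_eq_complex_def)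
  qed
  then show ?thesis by (simp add: psd_def M rot_diag_def)
qed

lemma support_proj_rot_diag:
  assumes xy: "x\<^sup>2 + y\<^sup>2 = 1"
  shows "support_proj (rot_diag x y l k) = rot_diag x y (if l = 0 then 0 else 1) (if k = 0 then 0 else 1)"
  by (simp add: support_proj_def mat_fun_rot_diag[OF xy])

section \<open>Positive definite matrices and the domain of the means\<close>

definition rpd :: "complex mat \<Rightarrow> bool" where
  "rpd M \<longleftrightarrow> (\<exists>a b c. M = rmat a b b c \<and> 0 < a \<and> 0 < c \<and> b\<^sup>2 < a * c)"

lemma rpd_rmat: "rpd (rmat a b b c) \<longleftrightarrow> 0 < a \<and> 0 < c \<and> b\<^sup>2 < a * c"
  by (auto simp: rpd_def rmat_eq_iff)

lemma rpd_imp_rpsd: "rpd M \<Longrightarrow> rpsd M"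
  unfolding rpd_def rpsd_def by (blast intro: less_imp_le)

lemma rpd_rot_diag:
  assumes "x\<^sup>2 + y\<^sup>2 = 1" "0 < l" "0 < k"
  shows "rpd (rot_diag x y l k)"
proof -
  have "(l * x\<^sup>2 + k * y\<^sup>2) * (l * y\<^sup>2 + k * x\<^sup>2) - ((l - k) * x * y)\<^sup>2 = l * k * (x\<^sup>2 + y\<^sup>2)\<^sup>2"
    by (simp add: power2_eq_square algebra_simps)
  also have "\<dots> > 0" using assms by simp
  finally have d: "((l - k) * x * y)\<^sup>2 < (l * x\<^sup>2 + k * y\<^sup>2) * (l * y\<^sup>2 + k * x\<^sup>2)" by simp
  then have "l * x\<^sup>2 + k * y\<^sup>2 \<noteq> 0" "l * y\<^sup>2 + k * x\<^sup>2 \<noteq> 0"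
    by (auto dest!: le_less_trans[OF zero_le_power2])
  moreover have "l * x\<^sup>2 + k * y\<^sup>2 \<ge> 0" "l * y\<^sup>2 + k * x\<^sup>2 \<ge> 0" using assms by auto
  ultimately show ?thesis
    unfolding rot_diag_def rpd_rmat using d by auto
qed

lemma rpd_diagonalize:
  assumes "rpd M"
  obtains x y l k where "x\<^sup>2 + y\<^sup>2 = 1" "0 < l" "0 < k" "M = rot_diag x y l k"
proof -
  obtain x y l k where xy: "x\<^sup>2 + y\<^sup>2 = 1" "0 \<le> l" "0 \<le> k" and M: "M = rot_diag x y l k"
    using rpd_imp_rpsd[OF assms] by (rule rpsd_diagonalize)
  obtain a b c where M2: "M = rmat a b b c" and p: "b\<^sup>2 < a * c"
    using assms by (auto simp: rpd_def)
  have abc: "a = l * x\<^sup>2 + k * y\<^sup>2" "b = (l - k) * x * y" "c = l * y\<^sup>2 + k * x\<^sup>2"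
    using M M2 by (simp_all add: rot_diag_def rmat_eq_iff)
  have "a * c - b\<^sup>2 = l * k * (x\<^sup>2 + y\<^sup>2)\<^sup>2"
    unfolding abc by (simp add: power2_eq_square algebra_simps)
  with p xy have "l * k > 0" by simp
  with xy have "l > 0" "k > 0" by (auto simp: zero_less_mult_iff)
  with that xy M show thesis by blast
qed

lemma rpd_mat_powr:
  assumes "rpd M" shows "rpd (mat_powr M r)"
  using assms by (elim rpd_diagonalize) (simp add: mat_powr_rot_diag rpd_rot_diag)

text \<open>A positive definite \<open>A\<close> has full support, so \<open>B\<close> may be
  singular; this admits second arguments of rank one.\<close>

lemma mean_domain_rpd:
  assumes "rpd A" "rpsd B"
  shows "(A, B) \<in> mean_domain 2"
proof -
  obtain x y l k where xy: "x\<^sup>2 + y\<^sup>2 = 1" "0 < l" "0 < k" and A: "A = rot_diag x y l k"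
    using assms(1) by (rule rpd_diagonalize)
  obtain z w m n where zw: "z\<^sup>2 + w\<^sup>2 = 1" "0 \<le> m" "0 \<le> n" and B: "B = rot_diag z w m n"
    using assms(2) by (rule rpsd_diagonalize)
  define m' where "m' = (if m = 0 then 0 else 1::real)"
  define n' where "n' = (if n = 0 then 0 else 1::real)"
  have sB: "support_proj B = rot_diag z w m' n'"
    by (simp add: B support_proj_rot_diag[OF zw(1)] m'_def n'_def)
  have "support_proj A = rmat 1 0 0 1"
    using xy by (simp add: A support_proj_rot_diag[OF xy(1)] rot_diag_const)
  \<comment> \<open>The identity is written in the eigenbasis of \<open>B\<close>, where the
    difference of the supports is diagonal.\<close>
  then have sA: "support_proj A = rot_diag z w 1 1" using zw by (simp add: rot_diag_const)
  have "support_proj A - support_proj B = rot_diag z w (1 - m') (1 - n')"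
    unfolding sA sB by (simp add: rot_diag_def rmat_minus algebra_simps)
  moreover have "rpsd (rot_diag z w (1 - m') (1 - n'))"
    by (rule rpsd_rot_diag) (auto simp: m'_def n'_def)
  ultimately have "psd 2 (support_proj A - support_proj B)" using psd_rpsd by simp
  then show ?thesis
    using assms psd_rpsd rpd_imp_rpsd
    by (auto simp: mean_domain_def loewner_le_def sB sA rot_diag_def)
qed

section \<open>The means at a second argument of rank one\<close>

lemma rpsd_wgeo_mean:
  assumes "rpsd A" "rpsd B" shows "rpsd (wgeo_mean \<alpha> A B)"
  unfolding wgeo_mean_def using assms by (intro rpsd_conj rpsd_mat_powr)

lemma rpsd_SG:
  assumes "rpsd A" "rpsd B" shows "rpsd (SG \<alpha> p A B)"
  unfolding SG_def Let_def using assms by (intro rpsd_conj rpsd_mat_powr rpsd_wgeo_mean)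

lemma rpsd_SG_tilde:
  assumes "rpsd A" "rpsd B" shows "rpsd (SG_tilde \<alpha> p A B)"
  unfolding SG_tilde_def Let_def using assms by (intro rpsd_conj rpsd_mat_powr rpsd_wgeo_mean)

text \<open>This is \<open>b u u^T\<close> with \<open>u = (x, y)\<close> of arbitrary length, so
  that conjugation by a symmetric matrix only changes \<open>u\<close>.\<close>

definition rank_one :: "real \<Rightarrow> real \<Rightarrow> real \<Rightarrow> complex mat" where
  "rank_one x y b = rmat (b * x\<^sup>2) (b * x * y) (b * x * y) (b * y\<^sup>2)"

lemma rpsd_rank_one: "0 \<le> b \<Longrightarrow> rpsd (rank_one x y b)"
  unfolding rank_one_def rpsd_rmat by (simp add: power2_eq_square algebra_simps)

text \<open>With \<open>n = x^2 + y^2\<close> the eigenvalues are \<open>b n\<close> and 0;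
  returning from the unit vector to \<open>(x, y)\<close> divides the power of \<open>b n\<close> by
  \<open>n\<close>.\<close>

lemma mat_powr_rank_one:
  assumes "0 \<le> b" and n: "0 < x\<^sup>2 + y\<^sup>2"
  shows "mat_powr (rank_one x y b) r = rank_one x y (b powr r * (x\<^sup>2 + y\<^sup>2) powr (r - 1))"
proof -
  define n where "n = x\<^sup>2 + y\<^sup>2"
  define s where "s = sqrt n"
  have s: "s\<^sup>2 = n" "0 < s" "n > 0" using assms by (auto simp: s_def n_def)
  have xy: "(x / s)\<^sup>2 + (y / s)\<^sup>2 = 1"
    using s by (simp add: power_divide flip: add_divide_distrib n_def)
  have E: "rank_one x y c = rot_diag (x / s) (y / s) (c * n) 0" for c
    using s by (simp add: rank_one_def rot_diag_def rmat_eq_iff power_divide flip: power2_eq_square)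
  have "b powr r * n powr (r - 1) * n = (b * n) powr r"
    using s assms by (simp add: powr_mult powr_diff)
  then show ?thesis
    unfolding n_def[symmetric] E using assms s by (simp add: mat_powr_rot_diag[OF xy])
qed

lemma rank_one_conj_left:
  "rmat a e e c * rank_one x y b * rmat a e e c = rank_one (a * x + e * y) (e * x + c * y) b"
  by (simp add: rank_one_def rmat_mult rmat_eq_iff power2_eq_square algebra_simps)

lemma rank_one_conj_right:
  "rank_one x y b * rmat a e e c * rank_one x y b = rank_one x y (b * b * qform x y (rmat a e e c))"
  by (simp add: rank_one_def rmat_mult rmat_eq_iff qform_rmat power2_eq_square algebra_simps)

lemma rpd_qform_pos:
  assumes "rpd M" "x\<^sup>2 + y\<^sup>2 = 1" shows "0 < qform x y M"
proof -
  obtain a b c where M: "M = rmat a b b c" and p: "0 < a" "0 < c" "b\<^sup>2 < a * c"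
    using assms by (auto simp: rpd_def)
  have "a * qform x y M = (a * x + b * y)\<^sup>2 + (a * c - b\<^sup>2) * y\<^sup>2"
    by (simp add: M qform_rmat power2_eq_square algebra_simps)
  also have "\<dots> > 0"
  proof (cases "y = 0")
    case True
    then have "x \<noteq> 0" using assms by auto
    then show ?thesis using True p by simp
  next
    case False
    then show ?thesis using p by (intro add_nonneg_pos) auto
  qed
  finally show ?thesis using p by (simp add: zero_less_mult_iff)
qed

lemma mat_powr_add:
  assumes "rpsd M"
  shows "mat_powr M r * mat_powr M s = mat_powr M (r + s)"
  using assms by (elim rpsd_diagonalize) (simp add: mat_powr_rot_diag rot_diag_mult powr_add)

lemma mat_powr_zero:
  assumes "rpd M" shows "mat_powr M 0 = 1\<^sub>m 2"
  using assms by (elim rpd_diagonalize) (simp add: mat_powr_rot_diag rot_diag_const rmat_one)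

lemma rpsd_carrier: "rpsd M \<Longrightarrow> M \<in> carrier_mat 2 2"
  by (auto simp: rpsd_def)

lemma mult_carrier_2 [simp]:
  "A \<in> carrier_mat 2 2 \<Longrightarrow> B \<in> carrier_mat 2 2 \<Longrightarrow> A * B \<in> carrier_mat 2 2"
  by (rule mult_carrier_mat)

lemma mat_powr_conj_cancel:
  assumes "rpd M" "E \<in> carrier_mat 2 2"
  shows "mat_powr M (- r) * (mat_powr M r * E * mat_powr M r) * mat_powr M (- r) = E"
proof -
  note M = rpd_imp_rpsd[OF assms(1)]
  let ?K = "mat_powr M r" and ?L = "mat_powr M (- r)"
  have [simp]: "?K \<in> carrier_mat 2 2" "?L \<in> carrier_mat 2 2"
    using rpsd_mat_powr[OF M] rpsd_carrier by auto
  have KL: "?K * ?L = 1\<^sub>m 2" "?L * ?K = 1\<^sub>m 2"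
    using mat_powr_add[OF M, of r "- r"] mat_powr_add[OF M, of "- r" r] mat_powr_zero[OF assms(1)] by simp_all
  have "?L * (?K * E * ?K) * ?L = (?L * ?K) * E * (?K * ?L)"
    using assms(2) by (simp add: assoc_mult_mat[of _ 2 2 _ 2 _ 2])
  then show ?thesis using assms(2) by (simp add: KL)
qed

text \<open>Conjugating \<open>c u u^T\<close> by \<open>M^(1/2)\<close> gives a rank one matrix
  along a vector of squared length \<open><u, M u>\<close>. Its power is a multiple of it, so the
  outer factors \<open>M^(-1/2)\<close> undo the conjugation.\<close>

lemma wgeo_mean_rank_one:
  assumes M: "rpd M" and xy: "x\<^sup>2 + y\<^sup>2 = 1" and c: "0 \<le> c"
  shows "wgeo_mean \<alpha> (mat_powr M (-1)) (rank_one x y c)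
    = rank_one x y (c powr \<alpha> * qform x y M powr (\<alpha> - 1))"
proof -
  note M' = rpd_imp_rpsd[OF M]
  have K: "rpsd (mat_powr M (1/2))" by (rule rpsd_mat_powr[OF M'])
  then obtain a e d where Ke: "mat_powr M (1/2) = rmat a e e d"
    by (auto simp: rpsd_def)
  have "M = rmat a e e d * rmat a e e d"
    using mat_powr_add[OF M', of "1/2" "1/2"] by (simp add: Ke mat_powr_one[OF M'])
  then have n: "(a * x + e * y)\<^sup>2 + (e * x + d * y)\<^sup>2 = qform x y M"
    by (simp add: rmat_mult qform_rmat power2_eq_square algebra_simps)
  have pos: "0 < qform x y M" by (rule rpd_qform_pos[OF M xy])
  have "wgeo_mean \<alpha> (mat_powr M (-1)) (rank_one x y c) =
     mat_powr M (-(1/2)) * mat_powr (mat_powr M (1/2) * rank_one x y c * mat_powr M (1/2)) \<alpha> * mat_powr M (-(1/2))"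
    by (simp add: wgeo_mean_def mat_powr_mat_powr[OF M'])
  also have "mat_powr (mat_powr M (1/2) * rank_one x y c * mat_powr M (1/2)) \<alpha>
     = mat_powr M (1/2) * rank_one x y (c powr \<alpha> * qform x y M powr (\<alpha> - 1)) * mat_powr M (1/2)"
    unfolding Ke rank_one_conj_left using c pos by (simp add: mat_powr_rank_one n)
  also have "mat_powr M (-(1/2)) * \<dots> * mat_powr M (-(1/2)) = rank_one x y (c powr \<alpha> * qform x y M powr (\<alpha> - 1))"
    by (rule mat_powr_conj_cancel[OF M]) (simp add: rank_one_def)
  finally show ?thesis .
qed

lemma trace_rank_one: "x\<^sup>2 + y\<^sup>2 = 1 \<Longrightarrow> Re (mat_trace (rank_one x y b)) = b"
  by (simp add: rank_one_def mat_trace_rmat flip: distrib_left)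

text \<open>With \<open>N = <u, A^p u>\<close> the inner mean is
  \<open>b^(p/2) N^(-1/2) u u^T\<close>, and compressing \<open>A^p\<close> to \<open>u\<close>
  contributes a further factor \<open>N\<close>.\<close>

lemma trace_SG_rank_one:
  assumes A: "rpd A" and xy: "x\<^sup>2 + y\<^sup>2 = 1" and b: "0 \<le> b" and p: "0 < p"
  shows "Re (mat_trace (SG \<alpha> p A (rank_one x y b))) =
    b powr \<alpha> * qform x y (mat_powr A p) powr ((1 - \<alpha>) / p)"
proof -
  note A' = rpd_imp_rpsd[OF A]
  have M: "rpd (mat_powr A p)" by (rule rpd_mat_powr[OF A])
  then obtain a e d where Me: "mat_powr A p = rmat a e e d"
    by (auto simp: rpd_def)
  define N where "N = qform x y (mat_powr A p)"
  have N: "0 < N" unfolding N_def by (rule rpd_qform_pos[OF M xy])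
  have G: "wgeo_mean (1/2) (mat_powr A (-p)) (mat_powr (rank_one x y b) p)
      = rank_one x y (b powr (p / 2) * N powr (- (1 / 2)))"
    using wgeo_mean_rank_one[OF M xy, of "b powr p" "1/2"] b
    by (simp add: mat_powr_mat_powr[OF A'] mat_powr_rank_one xy powr_powr N_def)
  have e: "((b powr (p / 2) * N powr (- (1 / 2))) powr \<alpha> * (b powr (p / 2) * N powr (- (1 / 2))) powr \<alpha> * N) powr (1 / p)
     = b powr \<alpha> * N powr ((1 - \<alpha>) / p)"
  proof -
    have "(b powr (p / 2) * N powr (- (1 / 2))) powr \<alpha> * (b powr (p / 2) * N powr (- (1 / 2))) powr \<alpha> * N
       = b powr (p * \<alpha>) * N powr (1 - \<alpha>)"
    proof -
      have "(b powr (p / 2) * N powr (- (1 / 2))) powr \<alpha> = b powr (p * \<alpha> / 2) * N powr (- \<alpha> / 2)"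
        using b N by (simp add: powr_mult powr_powr)
      moreover have "b powr (p * \<alpha> / 2) * b powr (p * \<alpha> / 2) = b powr (p * \<alpha>)"
        by (simp add: mult.commute flip: powr_add)
      moreover have "N powr (- \<alpha> / 2) * N powr (- \<alpha> / 2) * N = N powr (1 - \<alpha>)"
      proof -
        have "N powr (- \<alpha> / 2) * N powr (- \<alpha> / 2) * N powr 1 = N powr (1 - \<alpha>)"
          unfolding powr_add[symmetric] by (simp add: field_simps)
        then show ?thesis using N by simp
      qed
      ultimately show ?thesis by (metis (no_types, opaque_lifting) mult.assoc mult.left_commute)
    qed
    then show ?thesis using p b N by (simp add: powr_mult powr_powr)
  qed
  show ?thesis
    unfolding SG_def Let_def G
    using b N by (simp add: mat_powr_rank_one xy Me rank_one_conj_right trace_rank_one e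
        flip: N_def[unfolded Me])
qed

text \<open>Two powers of \<open>A\<close> occur, with exponents \<open>p\<close> and
  \<open>2 * (1 - \<alpha>) * p\<close>. They differ unless \<open>\<alpha> = 1/2\<close>, which
  \<open>SG_tilde_not_concave\<close> exploits.\<close>

lemma trace_SG_tilde_rank_one:
  assumes A: "rpd A" and xy: "x\<^sup>2 + y\<^sup>2 = 1" and b: "0 \<le> b" and p: "0 < p"
  shows "Re (mat_trace (SG_tilde \<alpha> p A (rank_one x y b))) =
    b powr \<alpha> * qform x y (mat_powr A p) powr ((\<alpha> - 1) / p)
      * qform x y (mat_powr A (2 * (1 - \<alpha>) * p)) powr (1 / p)"
proof -
  note A' = rpd_imp_rpsd[OF A]
  have M: "rpd (mat_powr A p)" and M2: "rpd (mat_powr A (2 * (1 - \<alpha>) * p))"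
    by (rule rpd_mat_powr[OF A])+
  from M2 obtain a e d where Me: "mat_powr A (2 * (1 - \<alpha>) * p) = rmat a e e d"
    by (auto simp: rpd_def)
  define N where "N = qform x y (mat_powr A p)"
  define N2 where "N2 = qform x y (mat_powr A (2 * (1 - \<alpha>) * p))"
  have N: "0 < N" "0 < N2" unfolding N_def N2_def using rpd_qform_pos M M2 xy by auto
  have G: "wgeo_mean \<alpha> (mat_powr A (-p)) (mat_powr (rank_one x y b) p)
      = rank_one x y (b powr (p * \<alpha>) * N powr (\<alpha> - 1))"
    using wgeo_mean_rank_one[OF M xy, of "b powr p" \<alpha>] b
    by (simp add: mat_powr_mat_powr[OF A'] mat_powr_rank_one xy powr_powr N_def mult.commute)
  have e: "((b powr (p * \<alpha>) * N powr (\<alpha> - 1)) powr (1/2) * (b powr (p * \<alpha>) * N powr (\<alpha> - 1)) powr (1/2) * N2) powr (1 / p)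
     = b powr \<alpha> * N powr ((\<alpha> - 1) / p) * N2 powr (1 / p)"
    unfolding powr_add[symmetric] using p b N by (simp add: powr_mult powr_powr)
  show ?thesis
    unfolding SG_tilde_def Let_def G Me
    using b N by (simp add: mat_powr_rank_one xy rank_one_conj_right trace_rank_one e
        flip: N_def N2_def[unfolded Me])
qed

section \<open>Consequences of joint concavity and convexity\<close>

lemma mat_convex_comb_rmat:
  "mat_convex_comb t (rmat a b c d) (rmat a' b' c' d') =
    rmat ((1 - t) * a + t * a') ((1 - t) * b + t * b') ((1 - t) * c + t * c') ((1 - t) * d + t * d')"
  by (simp add: mat_convex_comb_def rmat_smult rmat_add del: of_real_diff)

lemma trace_jointly_concaveD:
  assumes "trace_jointly_concave M" "rpd A" "rpsd B" "rpd A'" "rpsd B'" "0 \<le> t" "t \<le> 1"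
  shows "(1 - t) * Re (mat_trace (M A B)) + t * Re (mat_trace (M A' B'))
          \<le> Re (mat_trace (M (mat_convex_comb t A A') (mat_convex_comb t B B')))"
  using assms(1) mean_domain_rpd[OF assms(2,3)] mean_domain_rpd[OF assms(4,5)] assms(6,7)
  unfolding trace_jointly_concave_def by (fastforce dest!: spec[of _ 2])

lemma trace_jointly_convexD:
  assumes "trace_jointly_convex M" "rpd A" "rpsd B" "rpd A'" "rpsd B'" "0 \<le> t" "t \<le> 1"
  shows "Re (mat_trace (M (mat_convex_comb t A A') (mat_convex_comb t B B')))
    \<le> (1 - t) * Re (mat_trace (M A B)) + t * Re (mat_trace (M A' B'))"
  using assms(1) mean_domain_rpd[OF assms(2,3)] mean_domain_rpd[OF assms(4,5)] assms(6,7)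
  unfolding trace_jointly_convex_def by (fastforce dest!: spec[of _ 2])

text \<open>\<open>(A + C, B + D)\<close> is a convex combination of \<open>(A, B)\<close>, with weight close to one, and a far
  away point of the ray; nonnegativity at the latter gives monotonicity.\<close>

lemma rpsd_add:
  assumes "rpsd A" "rpsd B" shows "rpsd (A + B)" "rpd A \<Longrightarrow> rpd (A + B)"
proof -
  obtain a b c where A: "A = rmat a b b c" and a: "0 \<le> a" "0 \<le> c" "b\<^sup>2 \<le> a * c"
    using assms by (auto simp: rpsd_def)
  obtain d e f where B: "B = rmat d e e f" and d: "0 \<le> d" "0 \<le> f" "e\<^sup>2 \<le> d * f"
    using assms by (auto simp: rpsd_def)
  \<comment> \<open>The arithmetic-geometric mean inequality for \<open>a * f\<close> and
    \<open>c * d\<close> bounds the mixed term \<open>b * e\<close>, so adding \<open>B\<close> does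
    not decrease the determinant.\<close>
  have "(b * e)\<^sup>2 \<le> (a * c) * (d * f)" unfolding power_mult_distrib
    using a d by (intro mult_mono) auto
  also have "\<dots> \<le> ((a * f + c * d) / 2)\<^sup>2"
    using sum_squares_ge_zero[of "a * f - c * d" 0] by (simp add: power2_eq_square field_simps)
  finally have "b * e \<le> (a * f + c * d) / 2"
    by (rule power2_le_imp_le) (use a d in auto)
  then have "0 \<le> (d * f - e\<^sup>2) + 2 * ((a * f + c * d) / 2 - b * e)" using d by simp
  also have "\<dots> = ((a + d) * (c + f) - (b + e)\<^sup>2) - (a * c - b\<^sup>2)"
    by (simp add: power2_eq_square field_simps)
  finally have ge: "a * c - b\<^sup>2 \<le> (a + d) * (c + f) - (b + e)\<^sup>2" by simp
  show "rpsd (A + B)" unfolding A B rmat_add rpsd_rmat using ge a d by auto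
  show "rpd (A + B)" if "rpd A"
    using that ge d unfolding A B rmat_add rpd_rmat by (auto intro!: add_pos_nonneg)
qed

lemma trace_jointly_concave_mono:
  assumes conc: "trace_jointly_concave M"
    and nonneg: "\<And>A B. rpd A \<Longrightarrow> rpsd B \<Longrightarrow> 0 \<le> Re (mat_trace (M A B))"
    and A: "rpd A" and B: "rpsd B" and C: "rpsd (A' - A)" and D: "rpsd (B' - B)"
    and car: "A' \<in> carrier_mat 2 2" "B' \<in> carrier_mat 2 2"
  shows "Re (mat_trace (M A B)) \<le> Re (mat_trace (M A' B'))"
\<comment> \<open>It suffices to bound the left side times any \<open>s < 1\<close>; then
  \<open>1 - s\<close> is the weight of the far point.\<close>
proof (rule field_le_mult_one_interval)
  fix s :: real assume s: "0 < s" "s < 1"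
  define t where "t = 1 - s"
  have t: "0 < t" "t < 1" using s by (auto simp: t_def)
  have rep: "\<exists>X. (rpd A \<longrightarrow> rpd X) \<and> rpsd X \<and> mat_convex_comb t A X = A'"
    if A: "rpsd A" and C: "rpsd (A' - A)" and car: "A' \<in> carrier_mat 2 2" for A A'
  proof -
    obtain a b c where Ae: "A = rmat a b b c" and a: "0 \<le> a" "0 \<le> c" "b\<^sup>2 \<le> a * c"
      using A by (auto simp: rpsd_def)
    obtain d e f where Ce: "A' - A = rmat d e e f" and d: "0 \<le> d" "0 \<le> f" "e\<^sup>2 \<le> d * f"
      using C by (auto simp: rpsd_def)
    have "A' = A + (A' - A)"
      using car by (intro eq_matI) (auto simp: Ae)
    then have A': "A' = rmat (a + d) (b + e) (b + e) (c + f)"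
      unfolding Ce by (simp add: Ae rmat_add)
    \<comment> \<open>The increment is divided by the weight \<open>t\<close>, so that the
      combination adds exactly \<open>A' - A\<close>.\<close>
    define X where "X = rmat (a + d / t) (b + e / t) (b + e / t) (c + f / t)"
    have "mat_convex_comb t A X = A'"
      unfolding Ae X_def A' mat_convex_comb_rmat using t by (simp add: rmat_eq_iff field_simps)
    have "rpsd (rmat (d / t) (e / t) (e / t) (f / t))"
      using d t by (simp add: rpsd_rmat power_divide power2_eq_square divide_right_mono)
    moreover have "X = A + rmat (d / t) (e / t) (e / t) (f / t)" by (simp add: X_def Ae rmat_add)
    ultimately have "rpsd X" "rpd A \<Longrightarrow> rpd X"
      using rpsd_add A by auto
    then show ?thesis using \<open>mat_convex_comb t A X = A'\<close> by blast
  qed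
  obtain X where X: "rpd X" "mat_convex_comb t A X = A'"
    using rep[OF rpd_imp_rpsd[OF A] C car(1)] A by blast
  obtain Y where Y: "rpsd Y" "mat_convex_comb t B Y = B'"
    using rep[OF B D car(2)] by blast
  have "(1 - t) * Re (mat_trace (M A B)) + t * Re (mat_trace (M X Y)) \<le> Re (mat_trace (M A' B'))"
    using trace_jointly_concaveD[OF conc A B X(1) Y(1), of t] t X Y by simp
  moreover have "0 \<le> t * Re (mat_trace (M X Y))" using nonneg X Y t by simp
  ultimately show "s * Re (mat_trace (M A B)) \<le> Re (mat_trace (M A' B'))"
    by (simp add: t_def)
qed

section \<open>Factorized pairs\<close>

lemma rpd_conj:
  assumes "rpd K" "rpd M" shows "rpd (K * M * K)"
proof -
  obtain a b c where K: "K = rmat a b b c" and k: "b\<^sup>2 < a * c" using assms by (auto simp: rpd_def)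
  obtain p q r where M: "M = rmat p q q r" and m: "q\<^sup>2 < p * r" using assms by (auto simp: rpd_def)
  have "rpsd (K * M * K)" using assms rpsd_conj rpd_imp_rpsd by blast
  then obtain d e f where E: "K * M * K = rmat d e e f" and d: "0 \<le> d" "0 \<le> f"
    by (auto simp: rpsd_def)
  have def: "d = p * a\<^sup>2 + 2 * q * a * b + r * b\<^sup>2" "e = a * b * p + (a * c + b\<^sup>2) * q + b * c * r"
     "f = p * b\<^sup>2 + 2 * q * b * c + r * c\<^sup>2"
    using E by (simp_all add: K M rmat_mult rmat_eq_iff power2_eq_square algebra_simps)
  have "d * f - e\<^sup>2 = (a * c - b\<^sup>2)\<^sup>2 * (p * r - q\<^sup>2)"
    unfolding def by (simp add: power2_eq_square algebra_simps)
  also have "\<dots> > 0" using k m by simp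
  finally have df: "e\<^sup>2 < d * f" by simp
  then have "d \<noteq> 0" "f \<noteq> 0" by (auto dest!: le_less_trans[OF zero_le_power2])
  then show ?thesis using d df by (simp add: E rpd_rmat)
qed

text \<open>\<open>R\<^sup>-\<^sup>1 # B\<close> is the positive solution \<open>G\<close> of \<open>G R G = B\<close>.\<close>

lemma wgeo_mean_half_conj:
  assumes R: "rpd R" and H: "rpsd H"
  shows "wgeo_mean (1/2) (mat_powr R (-1)) (H * R * H) = H"
proof -
  note R' = rpd_imp_rpsd[OF R]
  let ?K = "mat_powr R (1/2)"
  note K = rpsd_mat_powr[OF R', of "1/2"]
  note [simp] = rpsd_carrier[OF K] rpsd_carrier[OF H] rpsd_carrier[OF R']
  have KK: "?K * ?K = R"
    using mat_powr_add[OF R', of "1/2" "1/2"] by (simp add: mat_powr_one[OF R'])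
  have "?K * (H * R * H) * ?K = ?K * (H * (?K * ?K) * H) * ?K" by (simp only: KK)
  also have "\<dots> = (?K * H * ?K) * (?K * H * ?K)"
    by (simp add: assoc_mult_mat[of _ 2 2 _ 2 _ 2])
  finally have "?K * (H * R * H) * ?K = (?K * H * ?K) * (?K * H * ?K)" .
  then have "mat_powr (?K * (H * R * H) * ?K) (1/2) = ?K * H * ?K"
    using mat_powr_square_half[OF rpsd_conj[OF K H]] by simp
  then show ?thesis
    using mat_powr_conj_cancel[OF R, of H "1/2"] by (simp add: wgeo_mean_def mat_powr_mat_powr[OF R'])
qed

text \<open>For these arguments the inner geometric mean is \<open>H\<close> by
  \<open>wgeo_mean_half_conj\<close>, so \<open>R\<close> and \<open>H\<close> serve as free
  parameters.\<close>

lemma SG_conj: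
  assumes R: "rpd R" and H: "rpd H" and p: "0 < p"
  shows "SG \<alpha> p (mat_powr R (1/p)) (mat_powr (H * R * H) (1/p))
    = mat_powr (mat_powr H \<alpha> * R * mat_powr H \<alpha>) (1/p)"
proof -
  note R' = rpd_imp_rpsd[OF R] and H' = rpd_imp_rpsd[OF H]
  have "rpsd (H * R * H)" by (rule rpsd_conj[OF H' R'])
  then show ?thesis
    using p by (simp add: SG_def mat_powr_mat_powr R' mat_powr_one wgeo_mean_half_conj[OF R H'])
qed

lemma mat_powr_mult_conj:
  assumes "rpsd H" "E \<in> carrier_mat 2 2"
  shows "mat_powr H r * (mat_powr H s * E * mat_powr H s) * mat_powr H r
    = mat_powr H (r + s) * E * mat_powr H (r + s)"
proof -
  have [simp]: "mat_powr H t \<in> carrier_mat 2 2" for t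
    using rpsd_mat_powr[OF assms(1)] rpsd_carrier by auto
  have "mat_powr H r * (mat_powr H s * E * mat_powr H s) * mat_powr H r
    = (mat_powr H r * mat_powr H s) * E * (mat_powr H s * mat_powr H r)"
    using assms(2) by (simp add: assoc_mult_mat[of _ 2 2 _ 2 _ 2])
  then show ?thesis by (simp add: mat_powr_add[OF assms(1)] add.commute)
qed

text \<open>Since \<open>R = H^(-1) (H R H) H^(-1)\<close>, the exchanged pair again has the form of
  \<open>SG_conj\<close>, with \<open>H^(-1)\<close> for \<open>H\<close>; its power
  \<open>H^(-\<alpha>)\<close> merges with \<open>H\<close>.\<close>

lemma SG_conj_swap:
  assumes R: "rpd R" and H: "rpd H" and p: "0 < p"
  shows "SG \<alpha> p (mat_powr (H * R * H) (1/p)) (mat_powr R (1/p))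
    = mat_powr (mat_powr H (1 - \<alpha>) * R * mat_powr H (1 - \<alpha>)) (1/p)"
proof -
  note R' = rpd_imp_rpsd[OF R] and H' = rpd_imp_rpsd[OF H]
  note Rc = rpsd_carrier[OF R']
  have H1: "mat_powr H 1 = H" by (rule mat_powr_one[OF H'])
  have "mat_powr H (-1) * (H * R * H) * mat_powr H (-1) = R"
    using mat_powr_conj_cancel[OF H Rc, of 1] by (simp add: H1)
  moreover have "mat_powr H (- \<alpha>) * (H * R * H) * mat_powr H (- \<alpha>) = mat_powr H (1 - \<alpha>) * R * mat_powr H (1 - \<alpha>)"
    using mat_powr_mult_conj[OF H' Rc, of "- \<alpha>" 1] by (simp add: H1)
  ultimately show ?thesis
    using SG_conj[OF rpd_conj[OF H R] rpd_mat_powr[OF H, of "-1"] p, of \<alpha>]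
    by (simp add: mat_powr_mat_powr[OF H'])
qed

section \<open>Bounds for traces of powers\<close>

text \<open>Superadditivity of \<open>t^m\<close> on the eigenvalues: divided by
  \<open>l + k\<close> they lie in [0,1], where \<open>t^m \<le> t\<close>.\<close>

lemma trace_mat_powr_le:
  assumes M: "rpsd M" and m: "1 \<le> m"
  shows "Re (mat_trace (mat_powr M m)) \<le> Re (mat_trace M) powr m"
proof -
  obtain x y l k where xy: "x\<^sup>2 + y\<^sup>2 = 1" and lk: "0 \<le> l" "0 \<le> k" and M: "M = rot_diag x y l k"
    using M by (rule rpsd_diagonalize)
  have "l powr m + k powr m \<le> (l + k) powr m"
  proof (cases "l + k = 0")
    case True
    then have "l = 0" "k = 0" using lk by auto
    then show ?thesis by simp
  next
    case False
    then have s: "l + k > 0" using lk by simp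
    have "(l / (l + k)) powr m \<le> (l / (l + k)) powr 1" "(k / (l + k)) powr m \<le> (k / (l + k)) powr 1"
      by (rule powr_mono'; use lk s m in simp)+
    then have "l powr m / (l + k) powr m \<le> l / (l + k)" "k powr m / (l + k) powr m \<le> k / (l + k)"
      using lk s by (simp_all add: powr_divide)
    then have "l powr m / (l + k) powr m + k powr m / (l + k) powr m \<le> l / (l + k) + k / (l + k)"
      by (rule add_mono)
    also have "\<dots> = 1" using s by (simp flip: add_divide_distrib)
    finally have "(l powr m + k powr m) / (l + k) powr m \<le> 1" by (simp add: add_divide_distrib)
    then show ?thesis using s by (simp add: divide_le_eq)
  qed
  then show ?thesis by (simp add: M mat_powr_rot_diag xy lk mat_trace_rot_diag)
qed

text \<open>The form at a unit vector is at most the largest eigenvalue, whose power is one of the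
  nonnegative summands of the trace.\<close>

lemma qform_powr_le_trace:
  assumes M: "rpsd M" and ab: "a\<^sup>2 + b\<^sup>2 = 1" and m: "0 \<le> m"
  shows "qform a b M powr m \<le> Re (mat_trace (mat_powr M m))"
proof -
  obtain x y l k where xy: "x\<^sup>2 + y\<^sup>2 = 1" and lk: "0 \<le> l" "0 \<le> k" and M: "M = rot_diag x y l k"
    using M by (rule rpsd_diagonalize)
  have q: "qform a b M = l * (a * x + b * y)\<^sup>2 + k * (b * x - a * y)\<^sup>2"
    by (simp add: M rot_diag_def qform_rmat power2_eq_square algebra_simps)
  have one: "(a * x + b * y)\<^sup>2 + (b * x - a * y)\<^sup>2 = 1"
  proof -
    have "(a * x + b * y)\<^sup>2 + (b * x - a * y)\<^sup>2 = (a\<^sup>2 + b\<^sup>2) * (x\<^sup>2 + y\<^sup>2)"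
      by (simp add: power2_eq_square algebra_simps)
    then show ?thesis by (simp add: ab xy)
  qed
  have "qform a b M \<le> max l k * (a * x + b * y)\<^sup>2 + max l k * (b * x - a * y)\<^sup>2"
    unfolding q by (intro add_mono mult_right_mono) auto
  also have "\<dots> = max l k" using one by (simp flip: distrib_left)
  finally have "qform a b M powr m \<le> max l k powr m"
    using lk m unfolding q by (intro powr_mono2) auto
  also have "\<dots> \<le> l powr m + k powr m" by (simp add: max_def)
  finally show ?thesis by (simp add: M mat_powr_rot_diag xy lk mat_trace_rot_diag)
qed

section \<open>Failures at a second argument of rank one\<close>

lemma rot_diag_axis: "rot_diag 1 0 l k = rmat l 0 0 k"
  by (simp add: rot_diag_def)

lemma mat_powr_diag: "0 \<le> l \<Longrightarrow> 0 \<le> k \<Longrightarrow> mat_powr (rmat l 0 0 k) r = rmat (l powr r) 0 0 (k powr r)"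
  unfolding rot_diag_axis[symmetric] by (rule mat_powr_rot_diag) auto

text \<open>Strict convexity of \<open>t^p\<close> about 1. The bound
  \<open>exp z \<ge> 1 + z\<close> reduces it to positivity of the sum of \<open>x ln x\<close> over
  3/2 and 1/2, hence to \<open>(3/2)^3 > 2\<close>.\<close>

lemma two_less_powr_sum:
  assumes "1 < p"
  shows "2 < (3/2::real) powr p + (1/2) powr p"
proof -
  have ge: "x * (1 + (p - 1) * ln x) \<le> x powr p" if "0 < x" for x :: real
  proof -
    have "x powr p = x * exp ((p - 1) * ln x)"
      using that by (simp add: powr_def algebra_simps exp_diff)
    then show ?thesis using that exp_ge_add_one_self[of "(p - 1) * ln x"] by simp
  qed
  have "ln (1/2::real) = - ln 2" by (simp add: ln_div)
  moreover have "ln (2::real) < 3 * ln (3/2)"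
  proof -
    have "3 * ln (3/2::real) = ln ((3/2) ^ 3)" by (simp add: ln_realpow)
    also have "\<dots> > ln 2" by (simp add: power3_eq_cube)
    finally show ?thesis .
  qed
  ultimately have "0 < (p - 1) * (3/2 * ln (3/2) + 1/2 * ln (1/2))"
    using assms by simp
  then have "2 < 2 + (p - 1) * (3/2 * ln (3/2) + 1/2 * ln (1/2))" by simp
  also have "\<dots> = 3/2 * (1 + (p - 1) * ln (3/2)) + 1/2 * (1 + (p - 1) * ln (1/2))"
    by (simp add: field_simps)
  also have "\<dots> \<le> (3/2) powr p + (1/2) powr p" by (intro add_mono ge) auto
  finally show ?thesis .
qed

text \<open>The matrix \<open>diag(3/2, 1/2)\<close> and its swap have the identity as midpoint.
  With \<open>B\<close> the projection onto the direction (1,1) both give the trace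
  \<open>N powr ((1 - \<alpha>) / p)\<close> with \<open>N > 1\<close>, and the identity gives
  1.\<close>

lemma SG_large_p:
  assumes "1 < p" "0 < \<alpha>"
  shows "\<alpha> < 1 \<Longrightarrow> \<not> trace_jointly_concave (SG \<alpha> p)" "1 < \<alpha> \<Longrightarrow> \<not> trace_jointly_convex (SG \<alpha> p)"
proof -
  define u where "u = sqrt (1/2)"
  have u: "u\<^sup>2 + u\<^sup>2 = 1" "u\<^sup>2 = 1/2" by (simp_all add: u_def)
  let ?\<phi> = "\<lambda>A. Re (mat_trace (SG \<alpha> p A (rank_one u u 1)))"
  let ?D = "\<lambda>a b. rmat a 0 0 b"
  have phi: "?\<phi> (?D a b) = ((a powr p + b powr p) / 2) powr ((1 - \<alpha>) / p)" if "0 < a" "0 < b" for a b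
  proof -
    have "rpd (?D a b)" using that by (simp add: rpd_rmat)
    then show ?thesis
      using that assms trace_SG_rank_one[of "?D a b" u u 1 p \<alpha>] u
      by (simp add: mat_powr_diag qform_rmat add_divide_distrib)
  qed
  define N where "N = ((3/2) powr p + (1/2) powr p) / (2::real)"
  have N: "N > 1" unfolding N_def using two_less_powr_sum[OF assms(1)] by simp
  have rpd: "rpd (?D (3/2) (1/2))" "rpd (?D (1/2) (3/2))" and B: "rpsd (rank_one u u 1)"
    by (simp_all add: rpd_rmat rpsd_rank_one)
  have c: "mat_convex_comb (1/2) (?D (3/2) (1/2)) (?D (1/2) (3/2)) = ?D 1 1"
      "mat_convex_comb (1/2) (rank_one u u 1) (rank_one u u 1) = rank_one u u 1"
    by (simp_all add: mat_convex_comb_rmat rank_one_def)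
  have v: "?\<phi> (?D (3/2) (1/2)) = N powr ((1 - \<alpha>) / p)" "?\<phi> (?D (1/2) (3/2)) = N powr ((1 - \<alpha>) / p)" "?\<phi> (?D 1 1) = 1"
    by (simp_all add: phi N_def add.commute)
  show "\<not> trace_jointly_concave (SG \<alpha> p)" if "\<alpha> < 1"
  proof
    assume "trace_jointly_concave (SG \<alpha> p)"
    from trace_jointly_concaveD[OF this rpd(1) B rpd(2) B, of "1/2"]
    have "N powr ((1 - \<alpha>) / p) \<le> 1" unfolding c v by simp
    moreover have "1 < N powr ((1 - \<alpha>) / p)" using N that assms by (intro gr_one_powr) auto
    ultimately show False by simp
  qed
  show "\<not> trace_jointly_convex (SG \<alpha> p)" if "1 < \<alpha>"
  proof
    assume "trace_jointly_convex (SG \<alpha> p)"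
    from trace_jointly_convexD[OF this rpd(1) B rpd(2) B, of "1/2"]
    have "1 \<le> N powr ((1 - \<alpha>) / p)" unfolding c v by simp
    moreover have "N powr ((1 - \<alpha>) / p) < N powr 0"
      using N that assms by (intro powr_less_mono) (auto simp: divide_neg_pos)
    ultimately show False using N by simp
  qed
qed

section \<open>The second mean at rank one matrices\<close>

lemma SG_tilde_half: "SG_tilde (1/2) p = SG (1/2) p"
  by (intro ext) (simp add: SG_tilde_def SG_def)

lemma powr_le_cancel_exponent:
  fixes u v r :: real
  assumes "u powr r \<le> v powr r" "0 < r" "0 \<le> v" shows "u \<le> v"
  using assms powr_less_mono2[of r v u] by (meson linorder_not_less)

text \<open>Enlarging \<open>A\<close> from \<open>diag(1, \<rho>0)\<close> to
  \<open>diag(2, \<rho>)\<close> raises the form of \<open>A^p\<close>, up to a common factor, from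
  2 to more than \<open>K\<close>, while that of \<open>A^q\<close> stays bounded. The former enters
  with the negative exponent \<open>\<alpha> - 1\<close>, so the trace drops, against
  monotonicity.\<close>

lemma SG_tilde_not_concave:
  assumes p: "0 < p" and \<alpha>: "0 < \<alpha>" "\<alpha> < 1" "\<alpha> \<noteq> 1/2"
  shows "\<not> trace_jointly_concave (SG_tilde \<alpha> p)"
proof
  assume conc: "trace_jointly_concave (SG_tilde \<alpha> p)"
  define q where "q = 2 * (1 - \<alpha>) * p"
  have qp: "q \<noteq> p" using p \<alpha> by (auto simp: q_def)
  \<comment> \<open>Chosen so that \<open>K powr (\<alpha> - 1) * (2 powr q + 2) = 2 powr (\<alpha>
    - 1)\<close>.\<close>
  define K where "K = 2 * (2 powr q + 2) powr (1 / (1 - \<alpha>))"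
  have "1 \<le> (2 powr q + 2) powr (1 / (1 - \<alpha>))"
    using \<alpha> by (intro ge_one_powr_ge_zero) auto
  then have K: "1 \<le> K" "0 < K" unfolding K_def by linarith+
  \<comment> \<open>\<open>\<rho>\<close> and \<open>w\<close> solve
    \<open>w * \<rho> powr p = K\<close> and \<open>w * \<rho> powr q = 1\<close>, possible because
    \<open>q \<noteq> p\<close>; \<open>\<rho>0\<close> then gives
    \<open>w * \<rho>0 powr p = 1\<close>.\<close>
  define \<rho> where "\<rho> = K powr (- 1 / (q - p))"
  define w where "w = K * \<rho> powr (- p)"
  define \<rho>0 where "\<rho>0 = K powr (- 1 / p) * \<rho>"
  have pos: "0 < \<rho>" "0 < w" "0 < \<rho>0" using K by (simp_all add: \<rho>_def w_def \<rho>0_def)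
  have wp: "w * \<rho> powr p = K" using pos by (simp add: w_def powr_minus)
  have "w * \<rho> powr q = K * \<rho> powr (q - p)"
    by (simp add: w_def mult.assoc flip: powr_add)
  also have "\<rho> powr (q - p) = K powr (- 1 / (q - p) * (q - p))" unfolding \<rho>_def by (rule powr_powr)
  also have "- 1 / (q - p) * (q - p) = -1" using qp by simp
  finally have wq: "w * \<rho> powr q = 1" using K by (simp add: powr_minus_divide)
  have "w * \<rho>0 powr p = K powr (-1) * (w * \<rho> powr p)"
    using p pos K by (simp add: \<rho>0_def powr_mult powr_powr)
  then have w0: "w * \<rho>0 powr p = 1" using K by (simp add: wp powr_minus_divide)
  have "K powr (- 1 / p) \<le> K powr 0" using K p by (intro powr_mono) auto
  then have le: "\<rho>0 \<le> \<rho>" using K pos by (simp add: \<rho>0_def)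
  \<comment> \<open>A unit vector whose squared coordinates have the ratio 1 to
    \<open>w\<close>.\<close>
  define x where "x = sqrt (1 / (1 + w))"
  define y where "y = sqrt (w / (1 + w))"
  have xy2: "x\<^sup>2 = 1 / (1 + w)" "y\<^sup>2 = w / (1 + w)" using pos by (simp_all add: x_def y_def)
  have xy: "x\<^sup>2 + y\<^sup>2 = 1" using pos unfolding xy2 by (simp flip: add_divide_distrib)
  let ?B = "rank_one x y 1"
  have phi: "Re (mat_trace (SG_tilde \<alpha> p (rmat a 0 0 b) ?B)) =
      ((1 + w) powr (- \<alpha>) * ((a powr p + w * b powr p) powr (\<alpha> - 1) * (a powr q + w * b powr q))) powr (1 / p)"
    if ab: "0 < a" "0 < b" for a b
  proof -
    have "rpd (rmat a 0 0 b)" using ab by (simp add: rpd_rmat)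
    from trace_SG_tilde_rank_one[OF this xy, of 1 p \<alpha>]
    have eq: "Re (mat_trace (SG_tilde \<alpha> p (rmat a 0 0 b) ?B)) =
      ((a powr p + w * b powr p) / (1 + w)) powr ((\<alpha> - 1) / p) * ((a powr q + w * b powr q) / (1 + w)) powr (1 / p)"
      using ab p by (simp add: mat_powr_diag qform_rmat xy2 q_def add_divide_distrib mult.commute)
    define Z where "Z = a powr p + w * b powr p"
    define Y where "Y = a powr q + w * b powr q"
    have ZY: "0 < Z" "0 < Y" unfolding Z_def Y_def using ab pos by (simp_all add: add_pos_pos)
    have "(Z / (1 + w)) powr ((\<alpha> - 1) / p) * (Y / (1 + w)) powr (1 / p)
        = ((Z / (1 + w)) powr (\<alpha> - 1) * (Y / (1 + w))) powr (1 / p)"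
      by (subst powr_mult) (use ZY pos in \<open>auto simp: powr_powr\<close>)
    also have "(Z / (1 + w)) powr (\<alpha> - 1) * (Y / (1 + w)) = (1 + w) powr (- \<alpha>) * (Z powr (\<alpha> - 1) * Y)"
    proof -
      define W where "W = 1 + w"
      have W: "0 < W" using pos by (simp add: W_def)
      have "W powr (- \<alpha>) = 1 / (W powr (\<alpha> - 1) * W)"
        using W by (simp add: powr_diff powr_minus_divide)
      then show ?thesis unfolding W_def[symmetric] using ZY W by (simp add: powr_divide)
    qed
    finally show ?thesis unfolding eq Z_def Y_def .
  qed
  have "Re (mat_trace (SG_tilde \<alpha> p (rmat 1 0 0 \<rho>0) ?B)) \<le> Re (mat_trace (SG_tilde \<alpha> p (rmat 2 0 0 \<rho>) ?B))"
  proof (rule trace_jointly_concave_mono[OF conc])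
    show "0 \<le> Re (mat_trace (SG_tilde \<alpha> p A B))" if "rpd A" "rpsd B" for A B
      using that rpd_imp_rpsd by (intro rpsd_trace_nonneg rpsd_SG_tilde) auto
    show "rpsd ?B" by (rule rpsd_rank_one) simp
  qed (use le pos in \<open>simp_all add: rmat_minus rpsd_rmat rpd_rmat rank_one_def\<close>)
  then have "((1 + w) powr (- \<alpha>) * (2 powr (\<alpha> - 1) * (1 + w * \<rho>0 powr q))) powr (1 / p)
      \<le> ((1 + w) powr (- \<alpha>) * ((2 powr p + K) powr (\<alpha> - 1) * (2 powr q + 1))) powr (1 / p)"
    using pos by (simp add: phi wp wq w0)
  then have "(1 + w) powr (- \<alpha>) * (2 powr (\<alpha> - 1) * (1 + w * \<rho>0 powr q))
      \<le> (1 + w) powr (- \<alpha>) * ((2 powr p + K) powr (\<alpha> - 1) * (2 powr q + 1))"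
    by (rule powr_le_cancel_exponent) (use p pos in \<open>auto intro!: mult_nonneg_nonneg add_nonneg_nonneg\<close>)
  then have "2 powr (\<alpha> - 1) * (1 + w * \<rho>0 powr q) \<le> (2 powr p + K) powr (\<alpha> - 1) * (2 powr q + 1)"
    using pos by simp
  moreover have "2 powr (\<alpha> - 1) * 1 \<le> 2 powr (\<alpha> - 1) * (1 + w * \<rho>0 powr q)"
    using pos by (intro mult_left_mono) auto
  moreover have "(2 powr p + K) powr (\<alpha> - 1) * (2 powr q + 1) \<le> K powr (\<alpha> - 1) * (2 powr q + 1)"
    using K \<alpha> by (intro mult_right_mono powr_mono2') auto
  moreover have "K powr (\<alpha> - 1) * (2 powr q + 1) < 2 powr (\<alpha> - 1)"
  proof -
    have "((2 powr q + 2) powr (1 / (1 - \<alpha>))) powr (\<alpha> - 1) = (2 powr q + 2) powr (1 / (1 - \<alpha>) * (\<alpha> - 1))"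
      by (rule powr_powr)
    also have "1 / (1 - \<alpha>) * (\<alpha> - 1) = -1" using \<alpha> by (simp add: field_simps)
    finally have "K powr (\<alpha> - 1) = 2 powr (\<alpha> - 1) * (1 / (2 powr q + 2))"
      by (simp add: K_def powr_mult powr_minus_divide add_pos_pos)
    then show ?thesis by (simp add: field_simps add_pos_pos)
  qed
  ultimately show False by linarith
qed

text \<open>The pair \<open>(diag(2, r), u u^T)\<close> is the midpoint of
  \<open>(2 I, 2 u u^T)\<close>, where the trace is 2, and a pair with second argument 0, where it
  is 0. Convexity bounds the trace at the midpoint by 1, but it grows at least like
  \<open>r powr (\<alpha> - 1)\<close>.\<close>

lemma SG_tilde_not_convex:
  assumes p: "0 < p" and \<alpha>: "1 < \<alpha>"
  shows "\<not> trace_jointly_convex (SG_tilde \<alpha> p)"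
proof
  assume conv: "trace_jointly_convex (SG_tilde \<alpha> p)"
  define u where "u = sqrt (1/2)"
  have u: "u\<^sup>2 + u\<^sup>2 = 1" "u\<^sup>2 = 1/2" by (simp_all add: u_def)
  define q where "q = 2 * (1 - \<alpha>) * p"
  have phi: "Re (mat_trace (SG_tilde \<alpha> p (rmat a 0 0 b) (rank_one u u c))) =
      c powr \<alpha> * ((a powr p + b powr p) / 2) powr ((\<alpha> - 1) / p) * ((a powr q + b powr q) / 2) powr (1 / p)"
    if "0 < a" "0 < b" "0 \<le> c" for a b c
  proof -
    have "rpd (rmat a 0 0 b)" using that by (simp add: rpd_rmat)
    then show ?thesis
      using that p trace_SG_tilde_rank_one[of "rmat a 0 0 b" u u c p \<alpha>] u
      by (simp add: mat_powr_diag qform_rmat add_divide_distrib q_def)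
  qed
  \<comment> \<open>The constant factor of the lower bound that remains after dropping
    \<open>2 powr p\<close> and \<open>r powr q\<close>.\<close>
  define L where "L = (1/2::real) powr ((\<alpha> - 1) / p) * (2 powr q / 2) powr (1 / p)"
  have L: "0 < L" by (simp add: L_def)
  \<comment> \<open>Large enough for \<open>r powr (\<alpha> - 1) * L \<ge> 2\<close>; the summand 2
    keeps \<open>2 * (r - 1)\<close> positive.\<close>
  define r where "r = 2 + (2 / L) powr (1 / (\<alpha> - 1))"
  have r: "2 \<le> r" by (simp add: r_def)
  have "2 / L = ((2 / L) powr (1 / (\<alpha> - 1))) powr (\<alpha> - 1)"
    using \<alpha> L by (simp add: powr_powr)
  also have "\<dots> \<le> r powr (\<alpha> - 1)" using \<alpha> by (intro powr_mono2) (auto simp: r_def)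
  finally have rL: "2 \<le> r powr (\<alpha> - 1) * L" using L by (simp add: field_simps)
  have A: "rpd (rmat 2 0 0 2)" "rpd (rmat 2 0 0 (2 * (r - 1)))" using r by (simp_all add: rpd_rmat)
  have B: "rpsd (rank_one u u 2)" "rpsd (rank_one u u 0)" by (simp_all add: rpsd_rank_one)
  have c: "mat_convex_comb (1/2) (rmat 2 0 0 2) (rmat 2 0 0 (2 * (r - 1))) = rmat 2 0 0 r"
    "mat_convex_comb (1/2) (rank_one u u 2) (rank_one u u 0) = rank_one u u 1"
    by (simp_all add: mat_convex_comb_rmat rank_one_def rmat_eq_iff field_simps)
  have "Re (mat_trace (SG_tilde \<alpha> p (rmat 2 0 0 (2 * (r - 1))) (rank_one u u 0))) = 0"
    using r by (subst phi) simp_all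
  then have "Re (mat_trace (SG_tilde \<alpha> p (rmat 2 0 0 r) (rank_one u u 1)))
     \<le> 1/2 * Re (mat_trace (SG_tilde \<alpha> p (rmat 2 0 0 2) (rank_one u u 2)))"
    using trace_jointly_convexD[OF conv A(1) B(1) A(2) B(2), of "1/2"] unfolding c by simp
  also have "Re (mat_trace (SG_tilde \<alpha> p (rmat 2 0 0 2) (rank_one u u 2))) = 2"
  proof -
    have "2 powr \<alpha> * (2 powr p) powr ((\<alpha> - 1) / p) * (2 powr q) powr (1 / p) = 2 powr (\<alpha> + p * ((\<alpha> - 1) / p) + q * (1 / p))"
      by (simp only: powr_powr powr_add)
    also have "\<alpha> + p * ((\<alpha> - 1) / p) + q * (1 / p) = 1"
      using p by (simp add: q_def field_simps)
    finally have "2 powr \<alpha> * (2 powr p) powr ((\<alpha> - 1) / p) * (2 powr q) powr (1 / p) = (2::real)"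
      by simp
    then show ?thesis by (simp add: phi)
  qed
  also have "Re (mat_trace (SG_tilde \<alpha> p (rmat 2 0 0 r) (rank_one u u 1)))
     = ((2 powr p + r powr p) / 2) powr ((\<alpha> - 1) / p) * ((2 powr q + r powr q) / 2) powr (1 / p)"
    using r by (simp add: phi)
  finally have "((2 powr p + r powr p) / 2) powr ((\<alpha> - 1) / p) * ((2 powr q + r powr q) / 2) powr (1 / p) \<le> 1"
    by simp
  moreover have "(1/2 * r powr p) powr ((\<alpha> - 1) / p) * (2 powr q / 2) powr (1 / p)
     \<le> ((2 powr p + r powr p) / 2) powr ((\<alpha> - 1) / p) * ((2 powr q + r powr q) / 2) powr (1 / p)"
    using \<alpha> p by (intro mult_mono powr_mono2) auto
  moreover have "(1/2 * r powr p) powr ((\<alpha> - 1) / p) * (2 powr q / 2) powr (1 / p) = r powr (\<alpha> - 1) * L"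
    unfolding L_def using p r by (subst powr_mult) (auto simp: powr_powr)
  ultimately show False using rL by linarith
qed

section \<open>The first mean for exponents at most one\<close>

text \<open>For \<open>T = diag(1, g\<^sup>2)\<close> and \<open>H\<close> with eigenvalues \<open>1, g\<close> and eigenvectors tilted by an
  angle of about \<open>g\<close>, the solution \<open>R\<close> of \<open>H R H = T\<close> has a corner entry that exceeds \<open>1\<close> by
  order \<open>g\<close>, whereas the trace of \<open>H\<^sup>\<beta> R H\<^sup>\<beta>\<close> exceeds \<open>1\<close> only by order \<open>g\<^sup>2\<^sup>\<beta>\<close>.\<close>

lemma tilted_factorization:
  fixes g :: real
  assumes g: "0 < g" "g \<le> 1/2"
  obtains H R X w v where "rpd H" "rpd R" "R = rmat X w w v" "1 + g \<le> X" "1/2 \<le> v"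
    "H * R * H = rmat 1 0 0 (g\<^sup>2)"
    "\<And>\<beta>. Re (mat_trace (mat_powr H \<beta> * R * mat_powr H \<beta>)) \<le> 1 + 2 * g powr (2 * \<beta>)"
    "\<And>\<beta>. \<exists>a b. a\<^sup>2 + b\<^sup>2 = 1 \<and> 1 - g\<^sup>2 \<le> qform a b (mat_powr H \<beta> * R * mat_powr H \<beta>)"
proof -
  \<comment> \<open>This makes \<open>(x, g)\<close> a unit vector; it will be the eigenvector of
    \<open>H\<close> for the eigenvalue 1.\<close>
  define x where "x = sqrt (1 - g\<^sup>2)"
  have g2: "g\<^sup>2 \<le> 1/4" using power_mono[OF g(2), of 2] g by (simp add: power2_eq_square)
  have x2: "x\<^sup>2 = 1 - g\<^sup>2" using g2 by (simp add: x_def)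
  have xg: "x\<^sup>2 + g\<^sup>2 = 1" by (simp add: x2)
  define H where "H = rot_diag x g 1 g"
  define T where "T = rmat 1 0 0 (g\<^sup>2)"
  define R where "R = mat_powr H (-1) * T * mat_powr H (-1)"
  have H: "rpd H" unfolding H_def using g by (intro rpd_rot_diag xg) auto
  note H' = rpd_imp_rpsd[OF H]
  have T: "rpd T" using g by (simp add: T_def rpd_rmat)
  note Tc = rpsd_carrier[OF rpd_imp_rpsd[OF T]]
  have R: "rpd R" unfolding R_def by (intro rpd_conj rpd_mat_powr H T)
  have HRH: "H * R * H = T"
    using mat_powr_conj_cancel[OF H Tc, of "-1"] by (simp add: R_def mat_powr_one[OF H'])
  have conj: "mat_powr H \<beta> * R * mat_powr H \<beta> = mat_powr H (\<beta> - 1) * T * mat_powr H (\<beta> - 1)" for \<beta>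
    using mat_powr_mult_conj[OF H' Tc, of \<beta> "-1"] by (simp add: R_def)
  have Hp: "mat_powr H r = rot_diag x g 1 (g powr r)" for r
    using g by (simp add: H_def mat_powr_rot_diag[OF xg])
  define P where "P = x\<^sup>2 + g"
  define q where "q = (1 - 1 / g) * x * g"
  define s where "s = g\<^sup>2 + x\<^sup>2 / g"
  have "mat_powr H (-1) = rmat P q q s"
    unfolding Hp using g by (simp add: rot_diag_def rmat_eq_iff P_def q_def s_def powr_minus_divide power2_eq_square)
  then have Re: "R = rmat (P\<^sup>2 + g\<^sup>2 * q\<^sup>2) (P * q + g\<^sup>2 * q * s) (P * q + g\<^sup>2 * q * s) (q\<^sup>2 + g\<^sup>2 * s\<^sup>2)"
    by (simp add: R_def T_def rmat_mult rmat_eq_iff power2_eq_square algebra_simps)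
  \<comment> \<open>The corner of \<open>R\<close> is at least \<open>P\<^sup>2\<close>, and
    \<open>P = 1 + g - g\<^sup>2 \<ge> 1 + g / 2\<close> because \<open>g \<le> 1/2\<close>.\<close>
  have "g * g \<le> g * (1/2)" using g by (intro mult_left_mono) auto
  then have "1 + g / 2 \<le> P" unfolding P_def x2 by (simp add: power2_eq_square)
  then have "(1 + g / 2)\<^sup>2 \<le> P\<^sup>2" using g by (intro power_mono) auto
  moreover have "1 + g \<le> (1 + g / 2)\<^sup>2" by (simp add: power2_eq_square field_simps)
  moreover have "0 \<le> g\<^sup>2 * q\<^sup>2" by simp
  ultimately have X: "1 + g \<le> P\<^sup>2 + g\<^sup>2 * q\<^sup>2" by linarith
  have "(3/4)\<^sup>2 \<le> (x\<^sup>2)\<^sup>2" using g2 by (intro power_mono) (auto simp: x2)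
  also have "\<dots> \<le> (g * s)\<^sup>2"
    using g by (intro power_mono) (auto simp: s_def distrib_left)
  finally have "9/16 \<le> g\<^sup>2 * s\<^sup>2" by (simp add: power_mult_distrib power_divide)
  moreover have "0 \<le> q\<^sup>2" by simp
  ultimately have v: "1/2 \<le> q\<^sup>2 + g\<^sup>2 * s\<^sup>2" by linarith
  have tr: "Re (mat_trace (mat_powr H \<beta> * R * mat_powr H \<beta>)) \<le> 1 + 2 * g powr (2 * \<beta>)" for \<beta>
  proof -
    define c where "c = g powr (\<beta> - 1)"
    have "mat_powr H (\<beta> - 1) * T * mat_powr H (\<beta> - 1) = rot_diag x g 1 c * T * rot_diag x g 1 c"
      by (simp add: Hp c_def)
    also have "Re (mat_trace \<dots>) = (x\<^sup>2 + c\<^sup>2 * g\<^sup>2) * (x\<^sup>2 + g\<^sup>2) + g\<^sup>2 * ((g\<^sup>2 + c\<^sup>2 * x\<^sup>2) * (x\<^sup>2 + g\<^sup>2))"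
      by (simp add: rot_diag_def T_def rmat_mult mat_trace_rmat power2_eq_square algebra_simps)
    also have "\<dots> = 1 + 2 * (c\<^sup>2 * g\<^sup>2) - g\<^sup>2 * (1 - g\<^sup>2) - c\<^sup>2 * (g\<^sup>2 * g\<^sup>2)"
      unfolding xg by (simp add: x2 algebra_simps)
    also have "\<dots> \<le> 1 + 2 * (c\<^sup>2 * g\<^sup>2)"
    proof -
      have "0 \<le> g\<^sup>2 * (1 - g\<^sup>2)" "0 \<le> c\<^sup>2 * (g\<^sup>2 * g\<^sup>2)" using g2 by simp_all
      then show ?thesis by linarith
    qed
    also have "c\<^sup>2 * g\<^sup>2 = (c * g powr 1)\<^sup>2" using g by (simp add: power_mult_distrib)
    also have "c * g powr 1 = g powr \<beta>" unfolding c_def powr_add[symmetric] by simp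
    also have "(g powr \<beta>)\<^sup>2 = g powr (2 * \<beta>)"
      unfolding power2_eq_square powr_add[symmetric] by simp
    finally show ?thesis unfolding conj .
  qed
  \<comment> \<open>Every power of \<open>H\<close> fixes \<open>(x, g)\<close>, so the form there
    equals that of \<open>T\<close>, namely
    \<open>x\<^sup>2 + g\<^sup>2 * g\<^sup>2\<close>.\<close>
  have top: "1 - g\<^sup>2 \<le> qform x g (mat_powr H \<beta> * R * mat_powr H \<beta>)" for \<beta>
  proof -
    define c where "c = g powr (\<beta> - 1)"
    have "mat_powr H (\<beta> - 1) * T * mat_powr H (\<beta> - 1) = rot_diag x g 1 c * T * rot_diag x g 1 c"
      by (simp add: Hp c_def)
    also have "qform x g \<dots> = (x\<^sup>2 + g\<^sup>2 * g\<^sup>2) * (x\<^sup>2 + g\<^sup>2)\<^sup>2"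
      by (simp add: rot_diag_def T_def rmat_mult qform_rmat power2_eq_square algebra_simps)
    finally show ?thesis unfolding conj xg x2 by simp
  qed
  show thesis
    using that[OF H R Re X v HRH[unfolded T_def] tr] top xg by blast
qed

text \<open>As \<open>2 * \<beta> > 1\<close>, the excess over 1 on the left is of smaller order
  than the growth \<open>(1 - \<beta>) * g\<close> on the right.\<close>

lemma exists_small_powr:
  fixes \<beta> :: real
  assumes "1/2 < \<beta>" "\<beta> < 1"
  shows "\<exists>g>0. g \<le> 1/2 \<and> 1 + 2 * g powr (2 * \<beta>) < (1 + g) powr (1 - \<beta>)"
proof -
  define a where "a = 1 - \<beta>"
  have a: "0 < a" using assms by (simp add: a_def)
  define g where "g = min (1/2) ((a / 8) powr (1 / (2 * \<beta> - 1)))"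
  have g: "0 < g" "g \<le> 1/2" using a by (auto simp: g_def)
  have "g powr (2 * \<beta> - 1) \<le> ((a / 8) powr (1 / (2 * \<beta> - 1))) powr (2 * \<beta> - 1)"
    using g assms by (intro powr_mono2) (auto simp: g_def)
  also have "\<dots> = a / 8" using a assms by (simp add: powr_powr)
  finally have "g powr (2 * \<beta> - 1) * g \<le> a / 8 * g" using g by (intro mult_right_mono) auto
  moreover have "g powr (2 * \<beta>) = g powr (2 * \<beta> - 1) * g" using g by (simp add: powr_diff)
  ultimately have "1 + 2 * g powr (2 * \<beta>) \<le> 1 + a * g / 4" by simp
  also have "\<dots> < 1 + a * (g / 2)" using a g by simp
  also have "\<dots> \<le> 1 + a * ln (1 + g)"
  proof -
    have "g / 2 \<le> g - g\<^sup>2"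
      using mult_left_mono[OF g(2), of g] g by (simp add: power2_eq_square)
    also have "\<dots> \<le> ln (1 + g)" using g by (intro ln_one_plus_pos_lower_bound) auto
    finally show ?thesis using a by simp
  qed
  also have "\<dots> \<le> exp (a * ln (1 + g))" by (rule exp_ge_add_one_self)
  also have "\<dots> = (1 + g) powr a" using g by (simp add: powr_def)
  finally show ?thesis using g unfolding a_def by blast
qed

text \<open>\<open>H0\<close> is diagonal and nearly of rank one, so \<open>H0 * R * H0\<close> is
  nearly \<open>\<kappa>\<close> times the projection onto the first axis. The form at that axis
  yields at least \<open>(\<kappa>^\<beta> X^(1 - \<beta>))^m\<close>, which exceeds the bound
  \<open>\<tau>^m\<close> for \<open>H\<close>. Keeping \<open>H0\<close> positive definite makes
  both \<open>SG_conj\<close> and \<open>SG_conj_swap\<close> applicable.\<close>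

lemma exists_tilted_counterexample:
  assumes \<beta>: "1/2 < \<beta>" "\<beta> < 1" and m: "1 \<le> m"
  obtains R H H0 where "rpd R" "rpd H" "rpd H0"
    "rpsd (mat_powr (H * R * H) m - mat_powr (H0 * R * H0) m)"
    "Re (mat_trace (mat_powr (mat_powr H \<beta> * R * mat_powr H \<beta>) m))
      < Re (mat_trace (mat_powr (mat_powr H0 \<beta> * R * mat_powr H0 \<beta>) m))"
proof -
  obtain g where g: "0 < g" "g \<le> 1/2" and gb: "1 + 2 * g powr (2 * \<beta>) < (1 + g) powr (1 - \<beta>)"
    using exists_small_powr[OF \<beta>] by blast
  obtain H R X w v where H: "rpd H" and R: "rpd R" and Re: "R = rmat X w w v"
    and X: "1 + g \<le> X" and v: "1/2 \<le> v" and HRH: "H * R * H = rmat 1 0 0 (g\<^sup>2)"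
    and tr: "\<And>\<beta>. Re (mat_trace (mat_powr H \<beta> * R * mat_powr H \<beta>)) \<le> 1 + 2 * g powr (2 * \<beta>)"
    using tilted_factorization[OF g] by metis
  note R' = rpd_imp_rpsd[OF R] and H' = rpd_imp_rpsd[OF H]
  define \<tau> where "\<tau> = 1 + 2 * g powr (2 * \<beta>)"
  have \<tau>: "0 < \<tau>" unfolding \<tau>_def by (intro add_pos_nonneg) auto
  have X0: "0 < X" using X g by simp
  have "(1 + g) powr (1 - \<beta>) \<le> X powr (1 - \<beta>)" using X g \<beta> by (intro powr_mono2) auto
  then have \<tau>X: "\<tau> < X powr (1 - \<beta>)" using gb by (simp add: \<tau>_def)
  \<comment> \<open>\<open>\<kappa>0\<close> solves
    \<open>\<kappa> powr \<beta> * X powr (1 - \<beta>) = \<tau>\<close>; taking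
    \<open>\<kappa>\<close> strictly below 1 leaves room for the off-diagonal entries.\<close>
  define \<kappa>0 where "\<kappa>0 = (\<tau> / X powr (1 - \<beta>)) powr (1 / \<beta>)"
  have "\<kappa>0 < 1 powr (1 / \<beta>)" unfolding \<kappa>0_def using \<tau> X0 \<beta> \<tau>X by (intro powr_less_mono2) auto
  then obtain \<kappa> where \<kappa>: "\<kappa>0 < \<kappa>" "\<kappa> < 1" using dense by auto
  have \<kappa>0: "0 < \<kappa>0" using \<tau> X0 by (simp add: \<kappa>0_def)
  have "\<tau> / X powr (1 - \<beta>) = \<kappa>0 powr \<beta>" using \<tau> X0 \<beta> by (simp add: \<kappa>0_def powr_powr)
  also have "\<dots> < \<kappa> powr \<beta>" using \<kappa> \<kappa>0 \<beta> by (intro powr_less_mono2) auto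
  finally have \<tau>\<kappa>: "\<tau> < \<kappa> powr \<beta> * X powr (1 - \<beta>)" using X0 by (simp add: field_simps)
  \<comment> \<open>This makes the corner entry of \<open>H0 * R * H0\<close> equal to
    \<open>\<kappa>\<close>.\<close>
  define c where "c = sqrt (\<kappa> / X)"
  have c: "0 < c" "c\<^sup>2 = \<kappa> / X" using \<kappa> \<kappa>0 X0 by (auto simp: c_def)
  have cX: "c\<^sup>2 * X = \<kappa>" using c X0 by simp
  define \<epsilon> where "\<epsilon> = 1 - \<kappa>"
  have \<epsilon>: "0 < \<epsilon>" using \<kappa> by (simp add: \<epsilon>_def)
  define \<gamma> where "\<gamma> = (g\<^sup>2) powr m"
  have \<gamma>: "0 < \<gamma>" using g by (simp add: \<gamma>_def)
  \<comment> \<open>\<open>h\<^sup>2 * M\<close> is the lower right entry of \<open>T0\<close> plus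
    the Schur complement term of its off-diagonal entry.\<close>
  define M where "M = c\<^sup>2 * v + c^4 * w\<^sup>2 / \<epsilon>"
  have M: "0 < M" unfolding M_def using c(1) v \<epsilon> by (intro add_pos_nonneg mult_pos_pos) auto
  define h where "h = sqrt (min \<epsilon> \<gamma> / M)"
  have h: "0 < h" "h\<^sup>2 = min \<epsilon> \<gamma> / M" using M \<epsilon> \<gamma> by (auto simp: h_def)
  have hM: "h\<^sup>2 * M \<le> \<epsilon>" "h\<^sup>2 * M \<le> \<gamma>" using h M by auto
  have hv: "h\<^sup>2 * (c\<^sup>2 * v) \<le> h\<^sup>2 * M"
    unfolding M_def using \<epsilon> by (intro mult_left_mono) auto
  define H0 where "H0 = rmat c 0 0 (c * h)"
  have H0: "rpd H0" using c h by (simp add: H0_def rpd_rmat)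
  note H0' = rpd_imp_rpsd[OF H0]
  define T0 where "T0 = H0 * R * H0"
  have T0: "T0 = rmat \<kappa> (c\<^sup>2 * h * w) (c\<^sup>2 * h * w) (h\<^sup>2 * (c\<^sup>2 * v))"
    unfolding T0_def cX[symmetric] by (simp add: H0_def Re rmat_mult rmat_eq_iff power2_eq_square)
  have "rpsd T0" unfolding T0_def by (rule rpsd_conj[OF H0' R'])
  then obtain x y l k where xy: "x\<^sup>2 + y\<^sup>2 = 1" and lk: "0 \<le> l" "0 \<le> k" and T0d: "T0 = rot_diag x y l k"
    by (rule rpsd_diagonalize)
  \<comment> \<open>The trace is at most \<open>\<kappa> + \<epsilon> = 1\<close>, so the
    eigenvalues lie in [0,1] and \<open>T0^m \<le> T0\<close> for \<open>m \<ge> 1\<close>.\<close>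
  have "l + k = Re (mat_trace T0)" by (simp add: T0d mat_trace_rot_diag xy)
  also have "\<dots> \<le> 1" using hM hv by (simp add: T0 mat_trace_rmat \<epsilon>_def)
  finally have lk1: "l \<le> 1" "k \<le> 1" using lk by auto
  have "l powr m \<le> l powr 1" "k powr m \<le> k powr 1" by (rule powr_mono'; use lk lk1 m in simp)+
  then have "rpsd (rot_diag x y (l - l powr m) (k - k powr m))" using lk by (intro rpsd_rot_diag) auto
  moreover have "rot_diag x y (l - l powr m) (k - k powr m) = T0 - mat_powr T0 m"
    unfolding T0d using lk by (simp add: mat_powr_rot_diag[OF xy]) (simp add: rot_diag_def rmat_minus rmat_eq_iff algebra_simps)
  ultimately have d1: "rpsd (T0 - mat_powr T0 m)" by simp
  have Tm: "mat_powr (H * R * H) m = rmat 1 0 0 \<gamma>" by (simp add: HRH mat_powr_diag \<gamma>_def)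
  have d2: "rpsd (rmat 1 0 0 \<gamma> - T0)"
  proof -
    have "(c\<^sup>2 * h * w)\<^sup>2 = \<epsilon> * (h\<^sup>2 * M - h\<^sup>2 * (c\<^sup>2 * v))"
      unfolding M_def using \<epsilon> by (simp add: power_mult_distrib algebra_simps flip: power_mult)
    also have "\<dots> \<le> \<epsilon> * (\<gamma> - h\<^sup>2 * (c\<^sup>2 * v))" using \<epsilon> hM by (intro mult_left_mono) auto
    finally have "(c\<^sup>2 * h * w)\<^sup>2 \<le> (1 - \<kappa>) * (\<gamma> - h\<^sup>2 * (c\<^sup>2 * v))" by (simp add: \<epsilon>_def)
    moreover have "0 \<le> 1 - \<kappa>" "0 \<le> \<gamma> - h\<^sup>2 * (c\<^sup>2 * v)" using \<kappa> hM hv by auto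
    ultimately show ?thesis by (simp only: T0 rmat_minus diff_0 rpsd_rmat power2_minus)
  qed
  have "rpsd (rmat 1 0 0 \<gamma> - mat_powr T0 m)"
  proof -
    obtain a b d where Tme: "mat_powr T0 m = rmat a b b d"
      using rpsd_mat_powr[OF \<open>rpsd T0\<close>, of m] by (auto simp: rpsd_def)
    have "rmat 1 0 0 \<gamma> - mat_powr T0 m = (rmat 1 0 0 \<gamma> - T0) + (T0 - mat_powr T0 m)"
      unfolding Tme by (simp add: T0 rmat_minus rmat_add)
    then show ?thesis using rpsd_add(1)[OF d2 d1] by simp
  qed
  then have le: "rpsd (mat_powr (H * R * H) m - mat_powr (H0 * R * H0) m)"
    by (simp add: Tm T0_def)
  have rp: "rpsd (mat_powr H \<beta> * R * mat_powr H \<beta>)" "rpsd (mat_powr H0 \<beta> * R * mat_powr H0 \<beta>)"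
    by (intro rpsd_conj rpsd_mat_powr H' H0' R')+
  have "Re (mat_trace (mat_powr (mat_powr H \<beta> * R * mat_powr H \<beta>) m)) \<le> \<tau> powr m"
  proof -
    have "Re (mat_trace (mat_powr (mat_powr H \<beta> * R * mat_powr H \<beta>) m))
        \<le> Re (mat_trace (mat_powr H \<beta> * R * mat_powr H \<beta>)) powr m"
      by (rule trace_mat_powr_le[OF rp(1) m])
    also have "\<dots> \<le> \<tau> powr m"
      unfolding \<tau>_def using m rpsd_trace_nonneg[OF rp(1)] tr by (intro powr_mono2) auto
    finally show ?thesis .
  qed
  also have "\<tau> powr m < (\<kappa> powr \<beta> * X powr (1 - \<beta>)) powr m"
    using \<tau> \<tau>\<kappa> m by (intro powr_less_mono2) auto
  also have "\<kappa> powr \<beta> * X powr (1 - \<beta>) = qform 1 0 (mat_powr H0 \<beta> * R * mat_powr H0 \<beta>)"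
  proof -
    have "qform 1 0 (mat_powr H0 \<beta> * R * mat_powr H0 \<beta>) = c powr \<beta> * c powr \<beta> * X"
      using c h by (simp add: H0_def mat_powr_diag Re rmat_mult qform_rmat)
    also have "c powr \<beta> * c powr \<beta> = (\<kappa> / X) powr \<beta>"
      using c by (simp add: power2_eq_square powr_mult flip: c(2))
    also have "\<dots> * X = \<kappa> powr \<beta> * X powr (1 - \<beta>)"
      using \<kappa> \<kappa>0 X0 by (simp add: powr_divide powr_diff)
    finally show ?thesis by simp
  qed
  also have "\<dots> powr m \<le> Re (mat_trace (mat_powr (mat_powr H0 \<beta> * R * mat_powr H0 \<beta>) m))"
    using qform_powr_le_trace[OF rp(2), of 1 0 m] m by simp
  finally show thesis using that[OF R H H0 le] by blast
qed

text \<open>With \<open>\<beta>\<close> the larger of \<open>\<alpha>\<close> and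
  \<open>1 - \<alpha>\<close>, the tilted pair enlarges the second argument if
  \<open>\<beta> = \<alpha>\<close> and the first if \<open>\<beta> = 1 - \<alpha>\<close>; either
  way the trace decreases.\<close>

lemma SG_small_p_not_concave:
  assumes p: "0 < p" "p \<le> 1" and \<alpha>: "0 < \<alpha>" "\<alpha> < 1" "\<alpha> \<noteq> 1/2"
  shows "\<not> trace_jointly_concave (SG \<alpha> p)"
proof
  assume conc: "trace_jointly_concave (SG \<alpha> p)"
  define \<beta> where "\<beta> = max \<alpha> (1 - \<alpha>)"
  have "\<alpha> < 1/2 \<or> 1/2 < \<alpha>" using \<alpha>(3) by linarith
  then have \<beta>: "1/2 < \<beta>" "\<beta> < 1" using \<alpha>(1,2) by (auto simp: \<beta>_def)
  have m: "1 \<le> 1 / p" using p by simp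
  obtain R H H0 where R: "rpd R" and H: "rpd H" and H0: "rpd H0"
    and le: "rpsd (mat_powr (H * R * H) (1/p) - mat_powr (H0 * R * H0) (1/p))"
    and less: "Re (mat_trace (mat_powr (mat_powr H \<beta> * R * mat_powr H \<beta>) (1/p)))
      < Re (mat_trace (mat_powr (mat_powr H0 \<beta> * R * mat_powr H0 \<beta>) (1/p)))"
    using exists_tilted_counterexample[OF \<beta> m] .
  let ?A = "mat_powr R (1/p)" and ?B = "mat_powr (H * R * H) (1/p)" and ?C = "mat_powr (H0 * R * H0) (1/p)"
  have rpd: "rpd ?A" "rpd ?B" "rpd ?C" by (intro rpd_mat_powr rpd_conj R H H0)+
  have car: "?A \<in> carrier_mat 2 2" "?B \<in> carrier_mat 2 2"
    using rpd rpd_imp_rpsd rpsd_carrier by auto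
  have zero: "rpsd (?A - ?A)"
    using rpd(1) by (auto simp: rpd_def rmat_minus rpsd_rmat)
  have nonneg: "0 \<le> Re (mat_trace (SG \<alpha> p A B))" if "rpd A" "rpsd B" for A B
    using that rpd_imp_rpsd by (intro rpsd_trace_nonneg rpsd_SG) auto
  have "\<beta> = \<alpha> \<or> \<beta> = 1 - \<alpha>" by (simp add: \<beta>_def max_def)
  then consider "\<beta> = \<alpha>" | "\<beta> = 1 - \<alpha>" by blast
  then show False
  proof cases
    case 1
    have "Re (mat_trace (SG \<alpha> p ?A ?C)) \<le> Re (mat_trace (SG \<alpha> p ?A ?B))"
      using trace_jointly_concave_mono[OF conc nonneg rpd(1) rpd_imp_rpsd[OF rpd(3)] zero le car] .
    then show False
      using less by (simp add: 1 SG_conj[OF R H p(1)] SG_conj[OF R H0 p(1)])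
  next
    case 2
    have "Re (mat_trace (SG \<alpha> p ?C ?A)) \<le> Re (mat_trace (SG \<alpha> p ?B ?A))"
      using trace_jointly_concave_mono[OF conc nonneg rpd(3) rpd_imp_rpsd[OF rpd(1)] le zero car(2,1)] .
    then show False
      using less by (simp add: 2 SG_conj_swap[OF R H p(1)] SG_conj_swap[OF R H0 p(1)])
  qed
qed

section \<open>Failure of convexity of the first mean\<close>

text \<open>Both sides agree at \<open>g = 0\<close>, and their difference has derivative
  \<open>- (a * m)\<close> there, since the terms in \<open>g\<^sup>2\<close> are flat.\<close>

lemma exists_small_deriv:
  fixes a m K :: real
  assumes "0 < a" "0 < m"
  shows "\<exists>g>0. g \<le> 1/2 \<and> (1 - g\<^sup>2) powr (- a) * (1 + g) powr (- (a * m)) + K * g\<^sup>2 < (1 - g\<^sup>2) powr m"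
proof -
  define f where "f g = (1 - g\<^sup>2) powr (- a) * (1 + g) powr (- (a * m)) + K * g\<^sup>2 - (1 - g\<^sup>2) powr m" for g :: real
  have "(f has_real_derivative - (a * m)) (at 0)"
    unfolding f_def by (auto intro!: derivative_eq_intros)
  from DERIV_neg_dec_right[OF this] assms obtain d where d: "0 < d" "\<And>h. 0 < h \<Longrightarrow> h < d \<Longrightarrow> f h < f 0"
    by auto
  define g where "g = min (1/2) (d / 2)"
  have "0 < g" "g < d" "g \<le> 1/2" using d(1) by (auto simp: g_def)
  then show ?thesis using d(2)[of g] by (auto simp: f_def)
qed

text \<open>\<open>diag(1, g^(2m))\<close> is split into rescaled rank one parts with weights
  \<open>1 - g\<^sup>2\<close> and \<open>g\<^sup>2\<close>. The first loses order \<open>g\<close>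
  because the corner of \<open>R\<close> is at least \<open>1 + g\<close>, the second adds only
  order \<open>g\<^sup>2\<close>, yet the whole keeps at least
  \<open>(1 - g\<^sup>2) powr m\<close>.\<close>

lemma SG_small_p_not_convex:
  assumes p: "0 < p" "p \<le> 1" and \<alpha>: "1 < \<alpha>"
  shows "\<not> trace_jointly_convex (SG \<alpha> p)"
proof
  assume conv: "trace_jointly_convex (SG \<alpha> p)"
  define m where "m = 1 / p"
  have m: "1 \<le> m" using p by (simp add: m_def)
  define a where "a = \<alpha> - 1"
  have a: "0 < a" using \<alpha> by (simp add: a_def)
  \<comment> \<open>The coefficient \<open>2 powr (a * m)\<close> will come from
    \<open>v \<ge> 1/2\<close> in the second rank one part.\<close>
  obtain g where g: "0 < g" "g \<le> 1/2" and less: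
    "(1 - g\<^sup>2) powr (- a) * (1 + g) powr (- (a * m)) + 2 powr (a * m) * g\<^sup>2 < (1 - g\<^sup>2) powr m"
    using exists_small_deriv[of a m] a m by auto
  obtain H R X w v where H: "rpd H" and R: "rpd R" and Re: "R = rmat X w w v"
    and X: "1 + g \<le> X" and v: "1/2 \<le> v" and HRH: "H * R * H = rmat 1 0 0 (g\<^sup>2)"
    and top: "\<And>\<beta>. \<exists>a b. a\<^sup>2 + b\<^sup>2 = 1 \<and> 1 - g\<^sup>2 \<le> qform a b (mat_powr H \<beta> * R * mat_powr H \<beta>)"
    using tilted_factorization[OF g] by metis
  note R' = rpd_imp_rpsd[OF R] and H' = rpd_imp_rpsd[OF H]
  have g2: "0 < g\<^sup>2" "g\<^sup>2 \<le> 1/4" using power_mono[OF g(2), of 2] g by (simp_all add: power2_eq_square)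
  let ?\<phi> = "\<lambda>B. Re (mat_trace (SG \<alpha> p (mat_powr R m) B))"
  let ?\<gamma> = "(g\<^sup>2) powr m"
  let ?B1 = "rank_one 1 0 (1 / (1 - g\<^sup>2))" and ?B2 = "rank_one 0 1 (?\<gamma> / g\<^sup>2)"
  have A: "rpd (mat_powr R m)" by (rule rpd_mat_powr[OF R])
  have Ap: "mat_powr (mat_powr R m) p = R" using p by (simp add: mat_powr_mat_powr R' mat_powr_one m_def)
  have e: "(1 - \<alpha>) / p = - (a * m)" by (simp add: a_def m_def diff_divide_distrib)
  have B: "rpsd ?B1" "rpsd ?B2" using g2 by (auto intro!: rpsd_rank_one)
  have c: "mat_convex_comb (g\<^sup>2) (mat_powr R m) (mat_powr R m) = mat_powr R m"
  proof -
    obtain b c d where "mat_powr R m = rmat b c c d" using A by (auto simp: rpd_def)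
    then show ?thesis by (simp add: mat_convex_comb_rmat rmat_eq_iff algebra_simps)
  qed
  have cB: "mat_convex_comb (g\<^sup>2) ?B1 ?B2 = mat_powr (H * R * H) m"
    using g2 by (simp add: HRH mat_powr_diag rank_one_def mat_convex_comb_rmat rmat_eq_iff)
  have "(1 - g\<^sup>2) powr m \<le> ?\<phi> (mat_powr (H * R * H) m)"
  proof -
    obtain s t where st: "s\<^sup>2 + t\<^sup>2 = 1" "1 - g\<^sup>2 \<le> qform s t (mat_powr H \<alpha> * R * mat_powr H \<alpha>)"
      using top[of \<alpha>] by auto
    have "(1 - g\<^sup>2) powr m \<le> qform s t (mat_powr H \<alpha> * R * mat_powr H \<alpha>) powr m"
      using st g2 m by (intro powr_mono2) auto
    also have "\<dots> \<le> Re (mat_trace (mat_powr (mat_powr H \<alpha> * R * mat_powr H \<alpha>) m))"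
      using m by (intro qform_powr_le_trace rpsd_conj rpsd_mat_powr H' R' st) auto
    finally show ?thesis unfolding m_def SG_conj[OF R H p(1)] .
  qed
  also have "\<dots> \<le> (1 - g\<^sup>2) * ?\<phi> ?B1 + g\<^sup>2 * ?\<phi> ?B2"
    using trace_jointly_convexD[OF conv A B(1) A B(2), of "g\<^sup>2"] g2 by (simp add: c cB)
  also have "(1 - g\<^sup>2) * ?\<phi> ?B1 = (1 - g\<^sup>2) powr (- a) * X powr (- (a * m))"
  proof -
    have "?\<phi> ?B1 = (1 / (1 - g\<^sup>2)) powr \<alpha> * X powr (- (a * m))"
      using trace_SG_rank_one[OF A, of 1 0 "1 / (1 - g\<^sup>2)" p \<alpha>] g2 p
      unfolding Ap e by (simp add: Re qform_rmat)
    moreover have "(1 - g\<^sup>2) * (1 / (1 - g\<^sup>2)) powr \<alpha> = (1 - g\<^sup>2) powr (- a)"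
      using g2 by (simp add: powr_divide a_def powr_diff)
    ultimately show ?thesis by (metis mult.assoc)
  qed
  also have "\<dots> \<le> (1 - g\<^sup>2) powr (- a) * (1 + g) powr (- (a * m))"
    using X g a m by (intro mult_left_mono powr_mono2') auto
  also have "g\<^sup>2 * ?\<phi> ?B2 \<le> 2 powr (a * m) * g\<^sup>2"
  proof -
    have "?\<phi> ?B2 = (?\<gamma> / g\<^sup>2) powr \<alpha> * v powr (- (a * m))"
      using trace_SG_rank_one[OF A, of 0 1 "?\<gamma> / g\<^sup>2" p \<alpha>] g2 p
      unfolding Ap e by (simp add: Re qform_rmat)
    also have "\<dots> \<le> 1 * 2 powr (a * m)"
    proof (rule mult_mono)
      have "?\<gamma> \<le> (g\<^sup>2) powr 1" by (rule powr_mono') (use g2 m in auto)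
      then have "?\<gamma> / g\<^sup>2 \<le> 1" using g2 by simp
      then show "(?\<gamma> / g\<^sup>2) powr \<alpha> \<le> 1" using \<alpha> by (intro powr_le1) auto
      have "v powr (- (a * m)) \<le> (1/2) powr (- (a * m))" using v a m by (intro powr_mono2') auto
      also have "\<dots> = 2 powr (a * m)" by (simp add: powr_minus powr_divide)
      finally show "v powr (- (a * m)) \<le> 2 powr (a * m)" .
    qed auto
    finally show ?thesis using g2 by simp
  qed
  finally show False using less by simp
qed

section \<open>Combination of the ranges of \<alpha> and \<open>p\<close>\<close>

theorem proposition5p19:
  fixes \<alpha> p :: real
  assumes "0 < \<alpha>" and "\<alpha> \<noteq> 1" and "0 < p"
  shows "(\<alpha> < 1 \<longrightarrow>
            (trace_jointly_concave (SG \<alpha> p) \<longrightarrow> p \<le> min ((1 - \<alpha>) / \<alpha>) (\<alpha> / (1 - \<alpha>))) \<and>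
            (trace_jointly_concave (SG_tilde \<alpha> p) \<longrightarrow> p \<le> 1)) \<and>
         (\<alpha> > 1 \<longrightarrow>
            \<not> trace_jointly_convex (SG \<alpha> p) \<and> \<not> trace_jointly_convex (SG_tilde \<alpha> p))"
proof (intro conjI impI)
  assume \<alpha>: "\<alpha> < 1"
  show "p \<le> min ((1 - \<alpha>) / \<alpha>) (\<alpha> / (1 - \<alpha>))" if conc: "trace_jointly_concave (SG \<alpha> p)"
  proof -
    have p: "p \<le> 1" using SG_large_p(1)[of p \<alpha>] assms \<alpha> conc by linarith
    \<comment> \<open>At \<open>\<alpha> = 1/2\<close> both quotients in the minimum equal
      1.\<close>
    then have "\<alpha> = 1/2" using SG_small_p_not_concave[of p \<alpha>] assms \<alpha> conc by blast
    then show ?thesis using p unfolding \<open>\<alpha> = 1/2\<close> by simp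
  qed
  show "p \<le> 1" if conc: "trace_jointly_concave (SG_tilde \<alpha> p)"
  proof -
    \<comment> \<open>Only the weight at which the two means coincide survives.\<close>
    have "\<alpha> = 1/2" using SG_tilde_not_concave[of p \<alpha>] assms \<alpha> conc by blast
    then show ?thesis using SG_large_p(1)[of p \<alpha>] conc SG_tilde_half[of p] by fastforce
  qed
next
  assume \<alpha>: "1 < \<alpha>"
  show "\<not> trace_jointly_convex (SG \<alpha> p)"
    using SG_large_p(2)[of p \<alpha>] SG_small_p_not_convex[of p \<alpha>] assms \<alpha> by linarith
  show "\<not> trace_jointly_convex (SG_tilde \<alpha> p)"
    by (rule SG_tilde_not_convex[OF assms(3) \<alpha>])
qed

end
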